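(* Let $\boldsymbol i=(i_1,i_2,i_3,i_4)\in\{(1,2,1,2),(2,1,2,1)\}$ and $\boldsymbol a=(a,b,c,d)$ with $a,b,c,d$ positive integers. Then the monomial $E_{\boldsymbol i}^{(\boldsymbol a)}=E_{i_1}^{(a)}E_{i_2}^{(b)}E_{i_3}^{(c)}E_{i_4}^{(d)}$ in $\mathbf U_v^+(\widehat{\mathfrak{sl}}_2)$ is tight if and only if $2b\ge a+c$ and $2c\ge b+d$, with at least one of these two inequalities strict.
   Context: $\mathbf U_v^+(\widehat{\mathfrak{sl}}_2)$ is the positive part of the quantum affine algebra of $\widehat{\mathfrak{sl}}_2$ over $\mathbb Q(v)$: it is generated by $E_1,E_2$ subject to the quantum Serre relations for the generalized Cartan matrix $\begin{pmatrix}2&-2\\-2&2\end{pmatrix}$. The divided powers are $E_i^{(m)}=E_i^m/[m]!$, with $[m]=(v^m-v^{-m})/(v-v^{-1})$ and $[m]!=[1][2]\cdots[m]$. A monomial $E_{i_1}^{(a_1)}\cdots E_{i_t}^{(a_t)}$ in divided powers is called tight if it belongs to (Lusztig's) canonical basis of $\mathbf U_v^+(\widehat{\mathfrak{sl}}_2)$. *)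

theory Defs
  imports "HOL-Computational_Algebra.Computational_Algebra" "HOL-Library.Poly_Mapping"
begin

section \<open>The field \<open>\<rat>(v)\<close>\<close>

type_synonym Qv = "rat poly fract"

definition v :: Qv where
  "v = to_fract [:0, 1:]"

lemma v_nonzero [simp]: "v \<noteq> 0"
  by (simp add: v_def)

definition qint :: "nat \<Rightarrow> Qv" where
  "qint m = (v ^ m - inverse v ^ m) / (v - inverse v)"

definition qfact :: "nat \<Rightarrow> Qv" where
  "qfact m = (\<Prod>k = 1..m. qint k)"

text \<open>\<open>p(v\<^sup>-\<^sup>1)\<close> for a polynomial \<open>p\<close>.\<close>

definition eval_inv :: "rat poly \<Rightarrow> Qv" where
  "eval_inv p = poly (map_poly (\<lambda>c. to_fract [:c:]) p) (inverse v)"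

lemma eval_inv_0 [simp]: "eval_inv 0 = 0"
  and eval_inv_pCons: "eval_inv (pCons a p) = to_fract [:a:] + inverse v * eval_inv p"
  by (simp_all add: eval_inv_def map_poly_pCons)

lemma to_fract_const_add: "to_fract [:a + b::rat:] = to_fract [:a:] + to_fract [:b:]"
  by (simp flip: to_fract_add)

lemma to_fract_const_mult: "to_fract [:a * b::rat:] = to_fract [:a:] * to_fract [:b:]"
  by (simp flip: to_fract_mult)

lemma eval_inv_add: "eval_inv (p + q) = eval_inv p + eval_inv q"
  by (induction p q rule: poly_induct2) (simp_all add: eval_inv_pCons to_fract_const_add algebra_simps)

lemma eval_inv_smult: "eval_inv (smult a p) = to_fract [:a:] * eval_inv p"
  by (induction p) (simp_all add: eval_inv_pCons to_fract_const_mult algebra_simps)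

lemma eval_inv_mult: "eval_inv (p * q) = eval_inv p * eval_inv q"
  by (induction p) (simp_all add: eval_inv_pCons eval_inv_add eval_inv_smult algebra_simps)

lemma eval_inv_1 [simp]: "eval_inv 1 = 1"
  by (simp add: one_pCons eval_inv_pCons) (simp flip: one_pCons)

lemma poly_v_conv_to_fract: "poly (map_poly (\<lambda>c. to_fract [:c:]) p) v = to_fract p"
proof (induction p)
  case (pCons a p)
  have "to_fract (pCons a p) = to_fract ([:a:] + [:0, 1:] * p)" by simp
  also have "\<dots> = to_fract [:a:] + v * to_fract p"
    unfolding v_def to_fract_add to_fract_mult ..
  finally show ?case using pCons by (simp add: map_poly_pCons)
qed simp

lemma eval_inv_nonzero: "p \<noteq> 0 \<Longrightarrow> eval_inv p \<noteq> 0"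
proof
  assume p: "p \<noteq> 0" and z: "eval_inv p = 0"
  let ?P = "map_poly (\<lambda>c. to_fract [:c:]) p"
  have deg: "degree ?P = degree p" by (rule degree_map_poly) simp_all
  have "reflect_poly ?P = map_poly (\<lambda>c. to_fract [:c:]) (reflect_poly p)"
    by (rule poly_eqI) (auto simp: coeff_map_poly coeff_reflect_poly deg)
  then have "to_fract (reflect_poly p) = poly (reflect_poly ?P) v"
    by (simp add: poly_v_conv_to_fract)
  also have "\<dots> = v ^ degree ?P * poly ?P (inverse v)"
    by (rule poly_reflect_poly_nz) simp
  also have "\<dots> = 0" using z by (simp add: eval_inv_def)
  finally show False using p by simp
qed

text \<open>The field automorphism of \<open>\<rat>(v)\<close> with \<open>v \<mapsto> v\<^sup>-\<^sup>1\<close>.\<close>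

definition bar_Qv :: "Qv \<Rightarrow> Qv" where
  "bar_Qv x = (THE y. \<exists>p q. q \<noteq> 0 \<and> x = Fract p q \<and> y = eval_inv p / eval_inv q)"

lemma bar_Qv_Fract:
  assumes "q \<noteq> 0"
  shows "bar_Qv (Fract p q) = eval_inv p / eval_inv q"
  unfolding bar_Qv_def
proof (rule the_equality)
  fix y
  assume "\<exists>p' q'. q' \<noteq> 0 \<and> Fract p q = Fract p' q' \<and> y = eval_inv p' / eval_inv q'"
  then obtain p' q' where *: "q' \<noteq> 0" "Fract p q = Fract p' q'" "y = eval_inv p' / eval_inv q'"
    by blast
  then have "p' * q = p * q'" using assms by (simp add: eq_fract)
  then have "eval_inv p' * eval_inv q = eval_inv p * eval_inv q'"
    by (simp flip: eval_inv_mult)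
  then show "y = eval_inv p / eval_inv q"
    using assms * by (simp add: eval_inv_nonzero frac_eq_eq)
qed (use assms in blast)

lemma bar_Qv_to_fract: "bar_Qv (to_fract p) = eval_inv p"
  by (simp add: to_fract_def bar_Qv_Fract)

lemma bar_Qv_0 [simp]: "bar_Qv 0 = 0" and bar_Qv_1 [simp]: "bar_Qv 1 = 1"
  using bar_Qv_to_fract[of 0] bar_Qv_to_fract[of 1] by simp_all

lemma bar_Qv_v [simp]: "bar_Qv v = inverse v"
  by (simp add: v_def bar_Qv_to_fract eval_inv_pCons) (simp flip: v_def one_pCons)

lemma bar_Qv_add: "bar_Qv (x + y) = bar_Qv x + bar_Qv y"
  by (cases x rule: Fract_cases; cases y rule: Fract_cases)
     (simp add: bar_Qv_Fract eval_inv_add eval_inv_mult eval_inv_nonzero add_frac_eq algebra_simps)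

lemma bar_Qv_mult: "bar_Qv (x * y) = bar_Qv x * bar_Qv y"
  by (cases x rule: Fract_cases; cases y rule: Fract_cases)
     (simp add: bar_Qv_Fract eval_inv_mult)

lemma bar_Qv_minus: "bar_Qv (- x) = - bar_Qv x"
  by (rule minus_unique[symmetric]) (simp flip: bar_Qv_add)

lemma bar_Qv_diff: "bar_Qv (x - y) = bar_Qv x - bar_Qv y"
  using bar_Qv_add[of x "- y"] by (simp add: bar_Qv_minus)

lemma bar_Qv_inverse: "bar_Qv (inverse x) = inverse (bar_Qv x)"
proof (cases "x = 0")
  case False
  then have "bar_Qv x * bar_Qv (inverse x) = 1" by (simp flip: bar_Qv_mult)
  then show ?thesis by (metis inverse_unique)
qed simp

lemma bar_Qv_power: "bar_Qv (x ^ n) = bar_Qv x ^ n"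
  by (induction n) (simp_all add: bar_Qv_mult)

lemma bar_Qv_qint [simp]: "bar_Qv (qint m) = qint m"
proof -
  have "bar_Qv (qint m) = (inverse v ^ m - v ^ m) / (inverse v - v)"
    by (simp add: qint_def divide_inverse bar_Qv_mult bar_Qv_diff bar_Qv_inverse bar_Qv_power)
  also have "\<dots> = qint m"
    unfolding qint_def by (metis minus_diff_eq minus_divide_divide)
  finally show ?thesis .
qed

lemma bar_Qv_qfact [simp]: "bar_Qv (qfact m) = qfact m"
  unfolding qfact_def by (induction m) (simp_all add: bar_Qv_mult)

section \<open>The free algebra on two generators\<close>

datatype node = N1 | N2

text \<open>The generalized Cartan matrix, which is also the symmetric form \<open>i \<cdot> j\<close>.\<close>

definition cartan :: "node \<Rightarrow> node \<Rightarrow> int" where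
  "cartan i j = (if i = j then 2 else -2)"

lemma cartan_sym: "cartan i j = cartan j i"
  by (simp add: cartan_def)

text \<open>
  The free monoid of words, written additively so that the finitely supported functions
  \<open>word \<Rightarrow>\<^sub>0 Qv\<close> with their convolution product form the free associative \<open>\<rat>(v)\<close>-algebra.
\<close>

datatype word = Word "node list"

instantiation word :: monoid_add
begin

definition zero_word :: word where
  "0 = Word []"

fun plus_word :: "word \<Rightarrow> word \<Rightarrow> word" where
  "Word xs + Word ys = Word (xs @ ys)"

instance
proof
  fix a b c :: word
  show "a + b + c = a + (b + c)" by (cases a; cases b; cases c) simp
  show "0 + a = a" "a + 0 = a" by (cases a; simp add: zero_word_def)+
qed

end

type_synonym free_alg = "word \<Rightarrow>\<^sub>0 Qv"

definition fconst :: "Qv \<Rightarrow> free_alg" where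
  "fconst c = Poly_Mapping.single 0 c"

definition fgen :: "node \<Rightarrow> free_alg" where
  "fgen i = Poly_Mapping.single (Word [i]) 1"

definition fdivpow :: "node \<Rightarrow> nat \<Rightarrow> free_alg" where
  "fdivpow i m = fconst (inverse (qfact m)) * fgen i ^ m"

lemma word_add_eq_0_iff: "(a :: word) + b = 0 \<longleftrightarrow> a = 0 \<and> b = 0"
  by (cases a; cases b) (simp add: zero_word_def)

lemma free_alg_induct [case_names zero single add]:
  fixes p :: "'k \<Rightarrow>\<^sub>0 'b::ab_group_add"
  assumes "P 0" "\<And>w c. P (Poly_Mapping.single w c)" "\<And>x y. P x \<Longrightarrow> P y \<Longrightarrow> P (x + y)"
  shows "P p"
proof -
  have "p = (\<Sum>w\<in>Poly_Mapping.keys p. Poly_Mapping.single w (Poly_Mapping.lookup p w))"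
    by (rule poly_mapping_eqI)
       (auto simp: lookup_sum lookup_single when_def sum.delta' in_keys_iff)
  moreover have "P (\<Sum>w\<in>A. Poly_Mapping.single w (Poly_Mapping.lookup p w))" if "finite A" for A
    using that by induction (auto intro: assms)
  ultimately show ?thesis by (metis finite_keys)
qed

lemma fconst_0 [simp]: "fconst 0 = 0"
  and fconst_1 [simp]: "fconst 1 = 1"
  and fconst_add: "fconst (a + b) = fconst a + fconst b"
  and fconst_minus: "fconst (- a) = - fconst a"
  and fconst_mult: "fconst (a * b) = fconst a * fconst b"
  by (simp_all add: fconst_def single_add single_uminus mult_single)

lemma fconst_central: "x * fconst c = fconst c * x"
  by (induction x rule: free_alg_induct)
     (simp_all add: fconst_def mult_single algebra_simps)

lemma fconst_left: "x * (fconst c * y) = fconst c * (x * y)"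
  by (metis fconst_central mult.assoc)

lemma fgen_fconst: "fgen i * (fconst c * x) = fconst c * (fgen i * x)"
  by (rule fconst_left)

lemma fconst_fconst: "fconst c * (fconst d * x) = fconst (c * d) * x"
  by (simp add: fconst_mult mult.assoc)

lemma fconst_single: "fconst c * Poly_Mapping.single w d = Poly_Mapping.single w (c * d)"
  by (simp add: fconst_def mult_single)

lemma single_Cons: "Poly_Mapping.single (Word (i # u)) c = fgen i * Poly_Mapping.single (Word u) c"
  by (simp add: fgen_def mult_single)

lemma single_Nil: "Poly_Mapping.single (Word []) c = fconst c"
  by (simp add: fconst_def zero_word_def)

lemma lookup_0_mult:
  "Poly_Mapping.lookup ((x :: free_alg) * y) 0 = Poly_Mapping.lookup x 0 * Poly_Mapping.lookup y 0"
proof (induction x rule: free_alg_induct)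
  case (single w c)
  show ?case
    by (induction y rule: free_alg_induct)
       (auto simp: mult_single lookup_single when_def word_add_eq_0_iff lookup_add algebra_simps)
qed (simp_all add: lookup_add algebra_simps)

section \<open>\<open>U\<^sub>v\<^sup>+\<close> as a quotient by the quantum Serre relations\<close>

definition serre :: "node \<Rightarrow> node \<Rightarrow> free_alg" where
  "serre i j = (\<Sum>r\<le>nat (1 - cartan i j).
     (- 1) ^ r * fdivpow i r * fgen j * fdivpow i (nat (1 - cartan i j) - r))"

inductive_set serre_ideal :: "free_alg set" where
  zero: "0 \<in> serre_ideal"
| gen: "i \<noteq> j \<Longrightarrow> x * serre i j * y \<in> serre_ideal"
| add: "x \<in> serre_ideal \<Longrightarrow> y \<in> serre_ideal \<Longrightarrow> x + y \<in> serre_ideal"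

lemma serre_ideal_mult_left: "x \<in> serre_ideal \<Longrightarrow> z * x \<in> serre_ideal"
proof (induction rule: serre_ideal.induct)
  case (gen i j x y)
  then show ?case using serre_ideal.gen[of i j "z * x" y] by (simp add: mult.assoc)
qed (auto simp: distrib_left intro: serre_ideal.intros)

lemma serre_ideal_mult_right: "x \<in> serre_ideal \<Longrightarrow> x * z \<in> serre_ideal"
proof (induction rule: serre_ideal.induct)
  case (gen i j x y)
  then show ?case using serre_ideal.gen[of i j x "y * z"] by (simp add: mult.assoc)
qed (auto simp: distrib_right intro: serre_ideal.intros)

lemma serre_ideal_uminus: "x \<in> serre_ideal \<Longrightarrow> - x \<in> serre_ideal"
  using serre_ideal_mult_left[of x "- 1"] by simp

lemma serre_ideal_diff: "x \<in> serre_ideal \<Longrightarrow> y \<in> serre_ideal \<Longrightarrow> x - y \<in> serre_ideal"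
  using serre_ideal.add[of x "- y"] by (simp add: serre_ideal_uminus)

lemma serre_ideal_lookup_0: "x \<in> serre_ideal \<Longrightarrow> Poly_Mapping.lookup x 0 = 0"
proof (induction rule: serre_ideal.induct)
  case (gen i j x y)
  have "Poly_Mapping.lookup (fgen k) 0 = 0" for k
    by (simp add: fgen_def lookup_single zero_word_def)
  then have "Poly_Mapping.lookup (serre i j) 0 = 0"
    by (simp add: serre_def lookup_sum lookup_0_mult)
  then show ?case by (simp add: lookup_0_mult)
qed (simp_all add: lookup_add)

quotient_type Uplus = free_alg / "\<lambda>x y. x - y \<in> serre_ideal"
proof (rule equivpI)
  show "reflp (\<lambda>x y. x - y \<in> serre_ideal)"
    by (auto intro!: reflpI serre_ideal.zero)
  show "symp (\<lambda>x y. x - y \<in> serre_ideal)"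
    by (auto intro!: sympI dest: serre_ideal_uminus)
  show "transp (\<lambda>x y. x - y \<in> serre_ideal)"
    by (auto intro!: transpI dest: serre_ideal.add)
qed

instantiation Uplus :: ring_1
begin

lift_definition zero_Uplus :: Uplus is 0 .
lift_definition one_Uplus :: Uplus is 1 .
lift_definition plus_Uplus :: "Uplus \<Rightarrow> Uplus \<Rightarrow> Uplus" is "(+)"
  by (drule (1) serre_ideal.add) (simp add: algebra_simps)
lift_definition uminus_Uplus :: "Uplus \<Rightarrow> Uplus" is uminus
  by (drule serre_ideal_uminus) simp
lift_definition minus_Uplus :: "Uplus \<Rightarrow> Uplus \<Rightarrow> Uplus" is "(-)"
  by (drule (1) serre_ideal_diff) (simp add: algebra_simps)
lift_definition times_Uplus :: "Uplus \<Rightarrow> Uplus \<Rightarrow> Uplus" is "(*)"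
proof -
  fix a b c d :: free_alg
  assume "a - b \<in> serre_ideal" "c - d \<in> serre_ideal"
  then have "(a - b) * c + b * (c - d) \<in> serre_ideal"
    by (intro serre_ideal.add serre_ideal_mult_left serre_ideal_mult_right)
  then show "a * c - b * d \<in> serre_ideal" by (simp add: algebra_simps)
qed

instance
proof
  show "(0::Uplus) \<noteq> 1"
  proof (transfer, rule notI)
    assume "0 - 1 \<in> serre_ideal"
    from serre_ideal_lookup_0[OF this] show False by (simp add: lookup_minus)
  qed
qed (transfer; simp add: algebra_simps serre_ideal.zero)+

end

lift_definition const :: "Qv \<Rightarrow> Uplus" is fconst .

definition scale :: "Qv \<Rightarrow> Uplus \<Rightarrow> Uplus" (infixr \<open>\<cdot>\<close> 75) where
  "c \<cdot> x = const c * x"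

lift_definition E :: "node \<Rightarrow> Uplus" is fgen .

definition divpow :: "node \<Rightarrow> nat \<Rightarrow> Uplus" where
  "divpow i m = inverse (qfact m) \<cdot> E i ^ m"

lemma vector_space_scale: "vector_space scale"
  by unfold_locales
     (unfold scale_def; transfer;
      simp add: fconst_add fconst_mult algebra_simps serre_ideal.zero)+

lemma scale_mult_left: "(c \<cdot> x) * y = c \<cdot> (x * y)"
  and scale_mult_right: "x * (c \<cdot> y) = c \<cdot> (x * y)"
  by (unfold scale_def; transfer; simp add: mult.assoc fconst_left serre_ideal.zero)+

section \<open>The bar involution\<close>

lemma lookup_map_bar: "Poly_Mapping.lookup (Poly_Mapping.map bar_Qv p) k = bar_Qv (Poly_Mapping.lookup p k)"
  by transfer (simp add: when_def)

lemma map_bar_add: "Poly_Mapping.map bar_Qv (x + y) = Poly_Mapping.map bar_Qv x + Poly_Mapping.map bar_Qv y"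
  by (rule poly_mapping_eqI) (simp add: lookup_map_bar lookup_add bar_Qv_add)

lemma map_bar_diff: "Poly_Mapping.map bar_Qv (x - y) = Poly_Mapping.map bar_Qv x - Poly_Mapping.map bar_Qv y"
  by (rule poly_mapping_eqI) (simp add: lookup_map_bar lookup_minus bar_Qv_diff)

lemma map_bar_0 [simp]: "Poly_Mapping.map bar_Qv 0 = 0"
  by (rule poly_mapping_eqI) (simp add: lookup_map_bar)

lemma map_bar_single [simp]:
  "Poly_Mapping.map bar_Qv (Poly_Mapping.single w c) = Poly_Mapping.single w (bar_Qv c)"
  by (rule map_single) simp

lemma map_bar_mult:
  "Poly_Mapping.map bar_Qv ((x :: free_alg) * y) = Poly_Mapping.map bar_Qv x * Poly_Mapping.map bar_Qv y"
proof (induction x rule: free_alg_induct)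
  case (single w c)
  show ?case
    by (induction y rule: free_alg_induct)
       (simp_all add: mult_single bar_Qv_mult map_bar_add algebra_simps)
qed (simp_all add: map_bar_add algebra_simps)

lemma map_bar_1 [simp]: "Poly_Mapping.map bar_Qv (1 :: free_alg) = 1"
  using map_bar_single[of 0 1] by simp

lemma map_bar_power: "Poly_Mapping.map bar_Qv ((x :: free_alg) ^ n) = Poly_Mapping.map bar_Qv x ^ n"
  by (induction n) (simp_all add: map_bar_mult)

lemma map_bar_sum: "Poly_Mapping.map bar_Qv (\<Sum>k\<in>A. f k) = (\<Sum>k\<in>A. Poly_Mapping.map bar_Qv (f k))"
  by (induction A rule: infinite_finite_induct) (simp_all add: map_bar_add)

lemma map_bar_fgen [simp]: "Poly_Mapping.map bar_Qv (fgen i) = fgen i"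
  by (simp add: fgen_def)

lemma map_bar_fdivpow [simp]: "Poly_Mapping.map bar_Qv (fdivpow i m) = fdivpow i m"
  by (simp add: fdivpow_def map_bar_mult map_bar_power fconst_def bar_Qv_inverse)

lemma map_bar_serre [simp]: "Poly_Mapping.map bar_Qv (serre i j) = serre i j"
proof -
  have "Poly_Mapping.map bar_Qv (- 1 :: free_alg) = - 1"
    using map_bar_diff[of 0 "1 :: free_alg"] by simp
  then show ?thesis by (simp add: serre_def map_bar_sum map_bar_mult map_bar_power)
qed

text \<open>The \<open>\<rat>\<close>-algebra automorphism fixing the generators and inverting \<open>v\<close>.\<close>

lift_definition bar :: "Uplus \<Rightarrow> Uplus" is "Poly_Mapping.map bar_Qv"
proof -
  fix x y :: free_alg
  have "z \<in> serre_ideal \<Longrightarrow> Poly_Mapping.map bar_Qv z \<in> serre_ideal" for z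
    by (induction rule: serre_ideal.induct)
       (simp_all add: map_bar_add map_bar_mult serre_ideal.intros)
  then show "x - y \<in> serre_ideal \<Longrightarrow>
      Poly_Mapping.map bar_Qv x - Poly_Mapping.map bar_Qv y \<in> serre_ideal"
    by (metis map_bar_diff)
qed

lemma bar_add: "bar (x + y) = bar x + bar y"
  by transfer (simp add: map_bar_add serre_ideal.zero)

lemma bar_mult: "bar (x * y) = bar x * bar y"
  by transfer (simp add: map_bar_mult serre_ideal.zero)

lemma bar_E: "bar (E i) = E i"
  by transfer (simp add: serre_ideal.zero)

lemma bar_scale: "bar (c \<cdot> x) = bar_Qv c \<cdot> bar x"
  unfolding scale_def by transfer (simp add: map_bar_mult fconst_def serre_ideal.zero)

section \<open>Lusztig's bilinear form\<close>

text \<open>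
  The skew derivation \<open>\<^sub>ir\<close> with \<open>\<^sub>ir(1) = 0\<close>, \<open>\<^sub>ir(E\<^sub>j) = \<delta>\<^sub>i\<^sub>j\<close> and
  \<open>\<^sub>ir(x y) = \<^sub>ir(x) y + v\<^bsup>|x| \<cdot> i\<^esup> x \<^sub>ir(y)\<close>, first on words.
\<close>

fun skew_word :: "node \<Rightarrow> node list \<Rightarrow> free_alg" where
  "skew_word i [] = 0"
| "skew_word i (j # u) = (if i = j then Poly_Mapping.single (Word u) 1 else 0)
     + fconst (v powi cartan i j) * fgen j * skew_word i u"

definition fskew :: "node \<Rightarrow> free_alg \<Rightarrow> free_alg" where
  "fskew i p = (\<Sum>w\<in>Poly_Mapping.keys p.
     fconst (Poly_Mapping.lookup p w) * (case w of Word u \<Rightarrow> skew_word i u))"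

text \<open>
  Lusztig's form, determined by \<open>(1, y) = \<epsilon>(y)\<close>, where \<open>\<epsilon>\<close> is the projection to degree zero,
  and \<open>(E\<^sub>i x, y) = (1 - v\<^sup>-\<^sup>2)\<^sup>-\<^sup>1 (x, \<^sub>ir(y))\<close>.
\<close>

fun word_form :: "node list \<Rightarrow> free_alg \<Rightarrow> Qv" where
  "word_form [] q = Poly_Mapping.lookup q 0"
| "word_form (i # u) q = inverse (1 - inverse v ^ 2) * word_form u (fskew i q)"

definition fform :: "free_alg \<Rightarrow> free_alg \<Rightarrow> Qv" where
  "fform p q = (\<Sum>w\<in>Poly_Mapping.keys p.
     Poly_Mapping.lookup p w * (case w of Word u \<Rightarrow> word_form u q))"

lemma fskew_superset:
  assumes "finite A" "Poly_Mapping.keys p \<subseteq> A"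
  shows "fskew i p = (\<Sum>w\<in>A. fconst (Poly_Mapping.lookup p w) * (case w of Word u \<Rightarrow> skew_word i u))"
  unfolding fskew_def using assms by (intro sum.mono_neutral_left) (auto simp: in_keys_iff)

lemma fform_superset:
  assumes "finite A" "Poly_Mapping.keys p \<subseteq> A"
  shows "fform p q = (\<Sum>w\<in>A. Poly_Mapping.lookup p w * (case w of Word u \<Rightarrow> word_form u q))"
  unfolding fform_def using assms by (intro sum.mono_neutral_left) (auto simp: in_keys_iff)

lemma fskew_0 [simp]: "fskew i 0 = 0"
  by (simp add: fskew_def)

lemma fskew_add: "fskew i (p + q) = fskew i p + fskew i q"
proof -
  let ?A = "Poly_Mapping.keys p \<union> Poly_Mapping.keys q"
  have "fskew i x = (\<Sum>w\<in>?A. fconst (Poly_Mapping.lookup x w) * (case w of Word u \<Rightarrow> skew_word i u))"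
    if "x \<in> {p, q, p + q}" for x
    using that Poly_Mapping.keys_add[of p q] by (intro fskew_superset) auto
  then show ?thesis
    by (simp add: lookup_add fconst_add distrib_right sum.distrib)
qed

lemma fskew_single: "fskew i (Poly_Mapping.single (Word u) c) = fconst c * skew_word i u"
  by (subst fskew_superset[of "{Word u}"]) auto

lemma fskew_fconst_mult: "fskew i (fconst c * p) = fconst c * fskew i p"
proof (induction p rule: free_alg_induct)
  case (single w d)
  then show ?case
    by (cases w) (simp add: fconst_single fskew_single fconst_mult mult.assoc)
qed (simp_all add: fskew_add distrib_left)

lemma fskew_fgen_mult:
  "fskew i (fgen j * p) = fconst (if i = j then 1 else 0) * p
     + fconst (v powi cartan i j) * (fgen j * fskew i p)"
proof (induction p rule: free_alg_induct)
  case (single w d)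
  obtain u where "w = Word u" by (cases w)
  then show ?case
    by (simp add: fskew_single fconst_single fconst_fconst fgen_fconst distrib_left mult.assoc mult.commute[of d]
          flip: single_Cons)
qed (simp_all add: fskew_add distrib_left)

lemma fform_0_left [simp]: "fform 0 q = 0"
  by (simp add: fform_def)

lemma fform_add_left: "fform (p + p') q = fform p q + fform p' q"
proof -
  let ?A = "Poly_Mapping.keys p \<union> Poly_Mapping.keys p'"
  have "fform x q = (\<Sum>w\<in>?A. Poly_Mapping.lookup x w * (case w of Word u \<Rightarrow> word_form u q))"
    if "x \<in> {p, p', p + p'}" for x
    using that Poly_Mapping.keys_add[of p p'] by (intro fform_superset) auto
  then show ?thesis
    by (simp add: lookup_add distrib_right sum.distrib)
qed

lemma fform_single: "fform (Poly_Mapping.single (Word u) c) q = c * word_form u q"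
  by (subst fform_superset[of "{Word u}"]) auto

lemma word_form_0 [simp]: "word_form u 0 = 0"
  by (induction u) simp_all

lemma word_form_add: "word_form u (p + q) = word_form u p + word_form u q"
  by (induction u arbitrary: p q) (simp_all add: lookup_add fskew_add algebra_simps)

lemma word_form_fconst_mult: "word_form u (fconst c * p) = c * word_form u p"
proof (induction u arbitrary: p)
  case Nil
  then show ?case by (simp add: lookup_0_mult fconst_def)
qed (simp add: fskew_fconst_mult)

lemma fform_add_right: "fform p (q + q') = fform p q + fform p q'"
proof (induction p rule: free_alg_induct)
  case (single w c)
  then show ?case by (cases w) (simp add: fform_single word_form_add algebra_simps)
qed (simp_all add: fform_add_left)

lemma fform_fconst_left: "fform (fconst c * p) q = c * fform p q"
proof (induction p rule: free_alg_induct)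
  case (single w d)
  then show ?case by (cases w) (simp add: fconst_single fform_single)
qed (simp_all add: fform_add_left distrib_left)

lemma fform_fconst_right: "fform p (fconst c * q) = c * fform p q"
proof (induction p rule: free_alg_induct)
  case (single w d)
  then show ?case by (cases w) (simp add: fform_single word_form_fconst_mult)
qed (simp_all add: fform_add_left distrib_left)

lemma fform_0_right [simp]: "fform p 0 = 0"
  using fform_fconst_right[of p 0 0] by simp

lemma fform_fgen_left: "fform (fgen i * p) q = inverse (1 - inverse v ^ 2) * fform p (fskew i q)"
proof (induction p rule: free_alg_induct)
  case (single w d)
  then show ?case by (cases w) (simp add: fform_single flip: single_Cons)
qed (simp_all add: fform_add_left distrib_left)

lemma fform_fgen_right: "fform p (fgen j * q) = inverse (1 - inverse v ^ 2) * fform (fskew j p) q"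
proof -
  let ?k = "inverse (1 - inverse v ^ 2)"
  have *: "fform (Poly_Mapping.single (Word u) 1) (fgen j * q)
      = ?k * fform (fskew j (Poly_Mapping.single (Word u) 1)) q" for u q
  proof (induction u arbitrary: q)
    case Nil
    have "Poly_Mapping.lookup (fgen j) 0 = 0"
      by (simp add: fgen_def lookup_single zero_word_def)
    then show ?case by (simp add: fform_single fskew_single lookup_0_mult)
  next
    case (Cons i u)
    let ?u = "Poly_Mapping.single (Word u) 1 :: free_alg"
    let ?d = "if i = j then 1 else 0 :: Qv"
    have "fform (fgen i * ?u) (fgen j * q) = ?k * fform ?u (fskew i (fgen j * q))"
      by (rule fform_fgen_left)
    also have "\<dots> = ?k * (?d * fform ?u q + v powi cartan i j * fform ?u (fgen j * fskew i q))"
      by (simp add: fskew_fgen_mult fform_add_right fform_fconst_right del: fconst_0 fconst_1)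
    also have "fform ?u (fgen j * fskew i q) = ?k * fform (fskew j ?u) (fskew i q)"
      by (rule Cons.IH)
    also have "\<dots> = fform (fgen i * fskew j ?u) q"
      by (rule fform_fgen_left[symmetric])
    also have "?k * (?d * fform ?u q + v powi cartan i j * fform (fgen i * fskew j ?u) q)
        = ?k * fform (fskew j (fgen i * ?u)) q"
      by (simp add: fskew_fgen_mult fform_add_left fform_fconst_left cartan_sym[of i j]
          eq_commute[of i j] del: fconst_0 fconst_1)
    finally show ?case by (simp add: single_Cons)
  qed
  show ?thesis
  proof (induction p rule: free_alg_induct)
    case (single w c)
    obtain u where w: "w = Word u" by (cases w)
    have "Poly_Mapping.single w c = fconst c * Poly_Mapping.single (Word u) 1"
      by (simp add: w fconst_single)
    then show ?case by (simp add: fform_fconst_left fskew_fconst_mult *)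
  qed (simp_all add: fform_add_left fskew_add distrib_left)
qed

lemma fform_sym: "fform p q = fform q p"
proof -
  have *: "fform (Poly_Mapping.single (Word u) 1) q = fform q (Poly_Mapping.single (Word u) 1)" for u q
  proof (induction u arbitrary: q)
    case Nil
    show ?case
    proof (induction q rule: free_alg_induct)
      case (single w c)
      obtain x where "w = Word x" by (cases w)
      then show ?case
        by (cases x) (simp_all add: fform_single lookup_single zero_word_def fskew_single)
    qed (simp_all add: fform_add_left fform_add_right)
  next
    case (Cons i u)
    then show ?case by (simp add: single_Cons fform_fgen_left fform_fgen_right)
  qed
  show ?thesis
  proof (induction p rule: free_alg_induct)
    case (single w c)
    obtain u where w: "w = Word u" by (cases w)
    have "Poly_Mapping.single w c = fconst c * Poly_Mapping.single (Word u) 1"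
      by (simp add: w fconst_single)
    then show ?case by (simp add: fform_fconst_left fform_fconst_right *)
  qed (simp_all add: fform_add_left fform_add_right)
qed

subsection \<open>Descent to the quotient\<close>

lemma v_square_neq_1: "v ^ 2 \<noteq> 1"
proof -
  have "v ^ 2 = to_fract [:0, 0, 1:]"
    by (simp add: v_def power2_eq_square flip: to_fract_mult)
  moreover have "[:0, 0, 1:] \<noteq> (1 :: rat poly)"
    by (simp add: one_pCons)
  ultimately show ?thesis by (metis to_fract_1 to_fract_eq_iff)
qed

lemma v_diff_nonzero: "v - inverse v \<noteq> 0"
proof
  assume "v - inverse v = 0"
  then have "v * v = 1" by (metis eq_iff_diff_eq_0 right_inverse v_nonzero)
  then show False using v_square_neq_1 by (simp add: power2_eq_square)
qed

lemma qint_1 [simp]: "qint (Suc 0) = 1"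
  using v_diff_nonzero by (simp add: qint_def)

lemma qint_3: "qint 3 = v ^ 2 + 1 + inverse v ^ 2"
proof -
  have "v ^ 3 - inverse v ^ 3 = (v - inverse v) * (v ^ 2 + v * inverse v + inverse v ^ 2)"
    by (simp add: power2_eq_square power3_eq_cube algebra_simps del: right_inverse left_inverse)
  then show ?thesis using v_diff_nonzero by (simp add: qint_def)
qed

lemma qint_3_nonzero: "qint 3 \<noteq> 0"
proof
  assume "qint 3 = 0"
  then have "v ^ 2 * (v ^ 2 + 1 + inverse v ^ 2) = 0" by (simp add: qint_3)
  moreover have "v ^ 2 * (v ^ 2 + 1 + inverse v ^ 2) = v * v * (v * v) + v * v + 1"
    by (simp add: algebra_simps power2_eq_square)
  moreover have "\<dots> = to_fract [:1, 0, 1, 0, 1:]"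
    by (simp add: v_def one_pCons flip: to_fract_mult to_fract_add to_fract_1)
  ultimately show False by simp
qed

lemma serre_expand:
  assumes "i \<noteq> j"
  shows "serre i j * y = fconst (inverse (qfact 3)) *
    (fgen j * (fgen i * (fgen i * (fgen i * y)))
     - fconst (qint 3) * (fgen i * (fgen j * (fgen i * (fgen i * y))))
     + fconst (qint 3) * (fgen i * (fgen i * (fgen j * (fgen i * y))))
     - fgen i * (fgen i * (fgen i * (fgen j * y))))"
proof -
  have [simp]: "qfact 0 = 1" "qfact (Suc 0) = 1"
    by (simp_all add: qfact_def)
  have q3: "qfact 3 = qfact 2 * qint 3"
    by (simp add: qfact_def numeral_3_eq_3 numeral_2_eq_2)
  have q: "inverse (qfact 3) * qint 3 = inverse (qfact 2)"
    using qint_3_nonzero by (simp add: q3)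
  have n: "nat (1 - cartan i j) = 3" using assms by (simp add: cartan_def)
  have f: "fdivpow i 0 = 1" "fdivpow i (Suc 0) = fgen i"
    "fdivpow i 2 = fconst (inverse (qfact 2)) * (fgen i * fgen i)"
    "fdivpow i 3 = fconst (inverse (qfact 3)) * (fgen i * (fgen i * fgen i))"
    by (simp_all add: fdivpow_def power2_eq_square power3_eq_cube mult.assoc)
  have "serre i j = fgen j * fdivpow i 3 - fdivpow i (Suc 0) * fgen j * fdivpow i 2
      + fdivpow i 2 * fgen j * fdivpow i (Suc 0) - fdivpow i 3 * fgen j"
    unfolding serre_def n by (simp add: numeral_3_eq_3 numeral_2_eq_2 f(1))
  then show ?thesis
    by (simp add: f fconst_fconst q mult.assoc fgen_fconst left_diff_distrib distrib_right
        right_diff_distrib distrib_left)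
qed

lemma fskew_minus: "fskew k (p - q) = fskew k p - fskew k q"
  by (metis add_diff_cancel diff_add_cancel fskew_add)

lemma fskew_serre_mult:
  assumes "i \<noteq> j"
  shows "\<exists>c. fskew k (serre i j * y) = fconst c * (serre i j * fskew k y)"
proof -
  define a b where "a = v powi cartan k i" and "b = v powi cartan k j"
  define n where "n = qint 3"
  define y' where "y' = fskew k y"
  let ?i = "fgen i" and ?j = "fgen j"
  note R = fskew_fgen_mult fgen_fconst fconst_fconst fconst_add distrib_left distrib_right
    mult.assoc add.assoc
  have "k = i \<or> k = j" using assms by (metis node.exhaust)
  then show ?thesis
  proof
    assume k: "k = i"
    have a: "a = v ^ 2" and b: "b = inverse (v ^ 2)"
      using assms by (simp_all add: a_def b_def k cartan_def power_int_minus)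
    have ab: "a * b = 1" and n: "n = a + 1 + b"
      by (simp_all add: a b n_def qint_3 power_inverse)
    have e: "v powi cartan i i = a" "v powi cartan i j = b"
      by (simp_all add: a_def b_def k)
    have T0: "fskew k (?j * (?i * (?i * (?i * y)))) =
        fconst (b * (1 + a + a * a)) * (?j * (?i * (?i * y)))
        + fconst (a * a * a * b) * (?j * (?i * (?i * (?i * y'))))"
      using assms by (simp add: R e k y'_def ac_simps)
    have T1: "fskew k (?i * (?j * (?i * (?i * y)))) =
        ?j * (?i * (?i * y)) + fconst (a * b * (1 + a)) * (?i * (?j * (?i * y)))
        + fconst (a * a * a * b) * (?i * (?j * (?i * (?i * y'))))"
      using assms by (simp add: R e k y'_def ac_simps)
    have T2: "fskew k (?i * (?i * (?j * (?i * y)))) =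
        fconst (1 + a) * (?i * (?j * (?i * y))) + fconst (a * a * b) * (?i * (?i * (?j * y)))
        + fconst (a * a * a * b) * (?i * (?i * (?j * (?i * y'))))"
      using assms by (simp add: R e k y'_def ac_simps)
    have T3: "fskew k (?i * (?i * (?i * (?j * y)))) =
        fconst (1 + a + a * a) * (?i * (?i * (?j * y)))
        + fconst (a * a * a * b) * (?i * (?i * (?i * (?j * y'))))"
      using assms by (simp add: R e k y'_def ac_simps)
    have c: "b * (n * a) = n" "a * b * (1 + a) = 1 + a" "a * a * b = a"
      "1 + a + a * a = n * a"
      using ab by (simp_all add: n algebra_simps)
    have "fskew k (serre i j * y) = fconst (a * a * a * b) * (serre i j * y')"
      unfolding serre_expand[OF assms] fskew_fconst_mult fskew_add fskew_minus
        T0 T1 T2 T3 c n_def[symmetric]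
      by (simp add: algebra_simps fconst_fconst)
    then show ?thesis by (auto simp: y'_def)
  next
    assume k: "k = j"
    have a: "a = inverse (v ^ 2)" and b: "b = v ^ 2"
      using assms by (simp_all add: a_def b_def k cartan_def power_int_minus)
    have ab: "a * b = 1" and n: "n = a + 1 + b"
      by (simp_all add: a b n_def qint_3 power_inverse)
    have e: "v powi cartan j i = a" "v powi cartan j j = b"
      by (simp_all add: a_def b_def k)
    have T0: "fskew k (?j * (?i * (?i * (?i * y)))) = ?i * (?i * (?i * y))
        + fconst (a * a * a * b) * (?j * (?i * (?i * (?i * y'))))"
      using assms by (simp add: R e k y'_def ac_simps)
    have T1: "fskew k (?i * (?j * (?i * (?i * y)))) = fconst a * (?i * (?i * (?i * y)))
        + fconst (a * a * a * b) * (?i * (?j * (?i * (?i * y'))))"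
      using assms by (simp add: R e k y'_def ac_simps)
    have T2: "fskew k (?i * (?i * (?j * (?i * y)))) = fconst (a * a) * (?i * (?i * (?i * y)))
        + fconst (a * a * a * b) * (?i * (?i * (?j * (?i * y'))))"
      using assms by (simp add: R e k y'_def ac_simps)
    have T3: "fskew k (?i * (?i * (?i * (?j * y)))) = fconst (a * a * a) * (?i * (?i * (?i * y)))
        + fconst (a * a * a * b) * (?i * (?i * (?i * (?j * y'))))"
      using assms by (simp add: R e k y'_def ac_simps)
    have "a * a * a = 1 - n * a + n * (a * a)"
      using ab by (simp add: n algebra_simps)
    then have c: "fconst (a * a * a) = 1 - fconst (n * a) + fconst (n * (a * a))"
      by (metis diff_add_eq diff_conv_add_uminus fconst_1 fconst_add fconst_minus)
    have "fskew k (serre i j * y) = fconst (a * a * a * b) * (serre i j * y')"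
      unfolding serre_expand[OF assms] fskew_fconst_mult fskew_add fskew_minus
        T0 T1 T2 T3 c n_def[symmetric]
      by (simp add: algebra_simps fconst_fconst)
    then show ?thesis by (auto simp: y'_def)
  qed
qed

lemma fskew_serre_ideal: "x \<in> serre_ideal \<Longrightarrow> fskew k x \<in> serre_ideal"
proof (induction rule: serre_ideal.induct)
  case (gen i j x y)
  define S where "S = serre i j"
  have S: "S * z \<in> serre_ideal" for z
    using serre_ideal.gen[OF gen, of 1 z] by (simp add: S_def)
  have word: "fskew k (Poly_Mapping.single (Word u) 1 * (S * y)) \<in> serre_ideal" for u
  proof (induction u)
    case Nil
    obtain c where "fskew k (S * y) = fconst c * (S * fskew k y)"
      using fskew_serre_mult[OF gen] S_def by blast
    then show ?case by (simp add: single_Nil serre_ideal_mult_left S)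
  next
    case (Cons i' u)
    then show ?case
      by (simp add: single_Cons fskew_fgen_mult mult.assoc serre_ideal.add serre_ideal_mult_left S
          serre_ideal.zero)
  qed
  have "fskew k (x * (S * y)) \<in> serre_ideal"
  proof (induction x rule: free_alg_induct)
    case (single w c)
    obtain u where "w = Word u" by (cases w)
    then have "Poly_Mapping.single w c = fconst c * Poly_Mapping.single (Word u) 1"
      by (simp add: fconst_single)
    then show ?case
      using word by (simp add: mult.assoc fskew_fconst_mult serre_ideal_mult_left)
  qed (simp_all add: distrib_right fskew_add serre_ideal.intros)
  then show ?case by (simp add: S_def mult.assoc)
qed (simp_all add: fskew_add serre_ideal.intros)

lemma fform_serre_ideal_right:
  assumes "q \<in> serre_ideal"
  shows "fform p q = 0"
proof -
  have *: "word_form u q = 0" if "q \<in> serre_ideal" for u q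
    using that by (induction u arbitrary: q) (simp_all add: serre_ideal_lookup_0 fskew_serre_ideal)
  show ?thesis
  proof (induction p rule: free_alg_induct)
    case (single w c)
    then show ?case using assms by (cases w) (simp add: fform_single *)
  qed (simp_all add: fform_add_left)
qed

lemma fform_serre_ideal_left: "p \<in> serre_ideal \<Longrightarrow> fform p q = 0"
  by (simp add: fform_sym[of p q] fform_serre_ideal_right)

lift_definition skew :: "node \<Rightarrow> Uplus \<Rightarrow> Uplus" is fskew
  by (metis fskew_minus fskew_serre_ideal)

lift_definition form :: "Uplus \<Rightarrow> Uplus \<Rightarrow> Qv" is fform
proof -
  fix x x' y y' :: free_alg
  assume x: "x - x' \<in> serre_ideal" and y: "y - y' \<in> serre_ideal"
  have "fform x y = fform (x' + (x - x')) (y' + (y - y'))" by simp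
  also have "\<dots> = fform x' y'"
    unfolding fform_add_left fform_add_right
    by (simp only: fform_serre_ideal_left[OF x] fform_serre_ideal_right[OF y] add_0_right)
  finally show "fform x y = fform x' y'" .
qed

lemma form_add_left: "form (x + x') y = form x y + form x' y"
  by transfer (rule fform_add_left)

lemma form_scale_left: "form (c \<cdot> x) y = c * form x y"
  unfolding scale_def by transfer (rule fform_fconst_left)

lemma form_sym: "form x y = form y x"
  by transfer (rule fform_sym)

lemma form_1_1: "form 1 1 = 1"
  by transfer (use fform_single[of "[]" 1 1] in \<open>simp flip: zero_word_def\<close>)

lemma form_E_left: "form (E i * x) y = inverse (1 - inverse v ^ 2) * form x (skew i y)"
  by transfer (rule fform_fgen_left)

lemma skew_E_mult:
  "skew i (E j * x) = (if i = j then x else 0) + v powi cartan i j \<cdot> (E j * skew i x)"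
  unfolding scale_def
  by transfer (simp add: fskew_fgen_mult serre_ideal.zero)

section \<open>The canonical basis\<close>

text \<open>\<open>\<A> = \<int>[v, v\<^sup>-\<^sup>1]\<close> inside \<open>\<rat>(v)\<close>.\<close>

definition laurent :: "Qv set" where
  "laurent = {to_fract (map_poly of_int p) / v ^ n | (p :: int poly) n. True}"

text \<open>Lusztig's \<open>\<A>\<close>-form, the \<open>\<A>\<close>-subalgebra generated by all divided powers.\<close>

inductive_set integral_form :: "Uplus set" where
  const: "c \<in> laurent \<Longrightarrow> const c \<in> integral_form"
| divpow: "divpow i m \<in> integral_form"
| add: "x \<in> integral_form \<Longrightarrow> y \<in> integral_form \<Longrightarrow> x + y \<in> integral_form"
| mult: "x \<in> integral_form \<Longrightarrow> y \<in> integral_form \<Longrightarrow> x * y \<in> integral_form"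

text \<open>The ideal \<open>v\<^sup>-\<^sup>1 (\<rat>(v) \<inter> \<rat>[[v\<^sup>-\<^sup>1]])\<close> of rational functions vanishing at \<open>v = \<infinity>\<close>.\<close>

definition vanishing_at_infinity :: "Qv set" where
  "vanishing_at_infinity = {Fract p q | p q. degree p < degree q}"

text \<open>
  Lusztig's signed basis \<open>\<B> = B \<squnion> - B\<close> (Introduction to Quantum Groups, Theorem 14.2.3),
  followed by his choice of signs (14.4.2).  Here \<open>\<B>\<^bsub>i;\<ge>n\<^esub> = \<B> \<inter> E\<^sub>i\<^sup>n U\<^sup>+\<close>, and
  \<open>\<pi>\<^bsub>i,n\<^esub> : \<B>\<^bsub>i;0\<^esub> \<rightarrow> \<B>\<^bsub>i;n\<^esub>\<close> is the bijection sending \<open>b\<close> to the unique \<open>b' \<in> \<B>\<^bsub>i;n\<^esub>\<close> with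
  \<open>E\<^sub>i\<^bsup>(n)\<^esup> b - b'\<close> an \<open>\<A>\<close>-linear combination of elements of \<open>\<B>\<^bsub>i;\<ge>n+1\<^esub>\<close>; the relation
  \<open>string_shift i n b b'\<close> is its graph.
\<close>

definition signed_basis :: "Uplus set" where
  "signed_basis = {x \<in> integral_form. bar x = x \<and> form x x - 1 \<in> vanishing_at_infinity}"

definition signed_basis_ge :: "node \<Rightarrow> nat \<Rightarrow> Uplus set" where
  "signed_basis_ge i n = signed_basis \<inter> range (\<lambda>y. E i ^ n * y)"

definition signed_basis_eq :: "node \<Rightarrow> nat \<Rightarrow> Uplus set" where
  "signed_basis_eq i n = signed_basis_ge i n - signed_basis_ge i (Suc n)"

definition laurent_span :: "Uplus set \<Rightarrow> Uplus set" where
  "laurent_span S = {\<Sum>x\<in>F. c x \<cdot> x | F c. finite F \<and> F \<subseteq> S \<and> c ` F \<subseteq> laurent}"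

definition string_shift :: "node \<Rightarrow> nat \<Rightarrow> Uplus \<Rightarrow> Uplus \<Rightarrow> bool" where
  "string_shift i n b b' \<longleftrightarrow> b \<in> signed_basis_eq i 0 \<and> b' \<in> signed_basis_eq i n \<and>
     divpow i n * b - b' \<in> laurent_span (signed_basis_ge i (Suc n))"

inductive_set canonical_basis :: "Uplus set" where
  one: "1 \<in> canonical_basis"
| shift: "b \<in> canonical_basis \<Longrightarrow> 0 < n \<Longrightarrow> string_shift i n b b' \<Longrightarrow> b' \<in> canonical_basis"

definition tight :: "Uplus \<Rightarrow> bool" where
  "tight m \<longleftrightarrow> m \<in> canonical_basis"

end

theory Submission
  imports Defs
begin

text \<open>
  Write \<open>m = E\<^sub>i\<^bsup>(a)\<^esup> E\<^sub>j\<^bsup>(b)\<^esup> E\<^sub>i\<^bsup>(c)\<^esup> E\<^sub>j\<^bsup>(d)\<^esup>\<close> with \<open>i \<noteq> j\<close>.  It is integral and bar invariant, so it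
  lies in the signed canonical basis exactly when its norm satisfies
  \<open>(m, m) \<in> 1 + v\<^sup>-\<^sup>1 \<rat>[[v\<^sup>-\<^sup>1]]\<close>.  The adjunction between multiplication by \<open>E\<^sub>i\<^bsup>(n)\<^esup>\<close> and the
  \<open>n\<close>-th power of the skew derivation, together with a quantum Leibniz rule
  (\<open>skew_pow_divpow\<close>), turns the norm into a sum over the ways in which \<open>x\<close> factors \<open>E\<^sub>i\<close> and \<open>y\<close>
  factors \<open>E\<^sub>j\<close> can change places, each summand being a product of Gaussian binomials, of a power
  of \<open>v\<close> and of series \<open>1 + O(v\<^sup>-\<^sup>1)\<close> (\<open>norm_four_factors\<close>).  Hence the \<open>(x, y)\<close> summand has
  leading term \<open>v\<close> to the power \<open>-2 Q(x, y)\<close> with coefficient \<open>1\<close>, where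
  \<open>Q(x, y) = x (2b - a - c) + y (2c - b - d) + (x - y)\<^sup>2\<close>.  All leading coefficients are positive, so
  nothing cancels, and the norm is \<open>1 + O(v\<^sup>-\<^sup>1)\<close> iff \<open>Q > 0\<close> at every admissible
  \<open>(x, y) \<noteq> (0, 0)\<close>.  The points \<open>(1, 0)\<close>, \<open>(0, 1)\<close> and \<open>(1, 1)\<close> give the three inequalities
  of the theorem, and these clearly suffice.

  As the canonical basis is contained in the signed one, this settles one implication.  For the
  other, the monomial is built up from \<open>1\<close> by multiplying with one divided power after the other;
  each step is an instance of the string bijections that fix the signs, provided that the factor
  already built is not left divisible by the next generator.  The essential case is
  \<open>E\<^sub>j\<^bsup>(b)\<^esup> E\<^sub>i\<^bsup>(c)\<^esup> E\<^sub>j\<^bsup>(d)\<^esup> \<notin> E\<^sub>i U\<^sup>+\<close> for \<open>c \<le> 2b\<close> (\<open>not_left_divisible\<close>).  The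
  projection of \<open>U\<^sup>+\<close> onto the kernel of the skew derivation along \<open>E\<^sub>i U\<^sup>+\<close> commutes with right
  multiplication by \<open>E\<^sub>j\<close>, and right multiplication by \<open>E\<^sub>j\<close> is injective on homogeneous elements;
  this reduces the claim to \<open>d = 0\<close>, where the projection of \<open>x = E\<^sub>j\<^bsup>(b)\<^esup> E\<^sub>i\<^bsup>(c)\<^esup>\<close> pairs with
  \<open>x\<close> to \<open>1 + O(v\<^sup>-\<^sup>1)\<close> and so does not vanish.
\<close>

section \<open>Leading behaviour of rational functions at infinity\<close>

lemma vanishing_0 [simp]: "0 \<in> vanishing_at_infinity"
  unfolding vanishing_at_infinity_def
  by (rule CollectI, rule exI[of _ 0], rule exI[of _ "[:0, 1:]"]) (simp add: Zero_fract_def eq_fract)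

lemma vanishing_add:
  assumes "x \<in> vanishing_at_infinity" "y \<in> vanishing_at_infinity"
  shows "x + y \<in> vanishing_at_infinity"
proof -
  obtain p q r s where *: "x = Fract p q" "degree p < degree q" "y = Fract r s" "degree r < degree s"
    using assms by (auto simp: vanishing_at_infinity_def)
  then have nz: "q \<noteq> 0" "s \<noteq> 0" by auto
  have "degree (p * s) < degree (q * s)" "degree (r * q) < degree (q * s)"
    using * nz degree_mult_le[of p s] degree_mult_le[of r q] by (auto simp: degree_mult_eq)
  then have "degree (p * s + r * q) < degree (q * s)" by (rule degree_add_less)
  moreover have "x + y = Fract (p * s + r * q) (q * s)" using * nz by simp
  ultimately show ?thesis unfolding vanishing_at_infinity_def by blast
qed

lemma vanishing_mult:
  assumes "x \<in> vanishing_at_infinity" "y \<in> vanishing_at_infinity"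
  shows "x * y \<in> vanishing_at_infinity"
proof -
  obtain p q r s where *: "x = Fract p q" "degree p < degree q" "y = Fract r s" "degree r < degree s"
    using assms by (auto simp: vanishing_at_infinity_def)
  then have nz: "q \<noteq> 0" "s \<noteq> 0" by auto
  have "degree (p * r) < degree (q * s)"
    using * nz degree_mult_le[of p r] by (auto simp: degree_mult_eq)
  moreover have "x * y = Fract (p * r) (q * s)" using * by simp
  ultimately show ?thesis unfolding vanishing_at_infinity_def by blast
qed

lemma vanishing_uminus:
  assumes "x \<in> vanishing_at_infinity"
  shows "- x \<in> vanishing_at_infinity"
proof -
  obtain p q where "x = Fract p q" "degree p < degree q"
    using assms by (auto simp: vanishing_at_infinity_def)
  then have "- x = Fract (- p) q" "degree (- p) < degree q" by simp_all
  then show ?thesis unfolding vanishing_at_infinity_def by blast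
qed

lemma vanishing_diff:
  assumes "x \<in> vanishing_at_infinity" "y \<in> vanishing_at_infinity"
  shows "x - y \<in> vanishing_at_infinity"
  using vanishing_add[OF assms(1) vanishing_uminus[OF assms(2)]] by simp

lemma vanishing_sum: "(\<And>s. s \<in> S \<Longrightarrow> f s \<in> vanishing_at_infinity) \<Longrightarrow> sum f S \<in> vanishing_at_infinity"
  by (induction S rule: infinite_finite_induct) (auto intro: vanishing_add)

lemma inverse_v_vanishing: "inverse v \<in> vanishing_at_infinity"
proof -
  have "inverse v = Fract 1 [:0, 1:]" by (simp add: v_def to_fract_def)
  then show ?thesis unfolding vanishing_at_infinity_def by fastforce
qed

lemma power_int_v_vanishing:
  assumes "e < 0" shows "v powi e \<in> vanishing_at_infinity"
proof -
  have "inverse v ^ Suc n \<in> vanishing_at_infinity" for n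
    by (induction n) (auto intro: vanishing_mult simp: inverse_v_vanishing)
  moreover obtain n where "e = - int (Suc n)" using assms by (metis int_cases linorder_not_less of_nat_0_le_iff)
  moreover have "v powi (- int (Suc n)) = inverse v ^ Suc n"
    by (simp only: power_int_minus power_int_of_nat power_inverse)
  ultimately show ?thesis by simp
qed

lemma of_nat_vanishing_iff: "of_nat n \<in> vanishing_at_infinity \<longleftrightarrow> n = 0"
proof
  assume "of_nat n \<in> vanishing_at_infinity"
  then obtain p q where *: "(of_nat n :: Qv) = Fract p q" "degree p < degree q"
    unfolding vanishing_at_infinity_def by blast
  then have "q \<noteq> 0" by auto
  moreover have "(of_nat n :: Qv) = Fract (of_nat n) 1" by (simp add: of_nat_fract)
  ultimately have "of_nat n * q = p" using * by (simp add: eq_fract)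
  then have "smult (of_nat n) q = p" by (simp add: of_nat_poly)
  then have "n \<noteq> 0 \<Longrightarrow> degree p = degree q" by (metis degree_smult_eq of_nat_eq_0_iff)
  then show "n = 0" using * by linarith
qed simp

text \<open>
  The function \<open>x\<close> has leading term \<open>v\<^sup>e\<close> at \<open>v = \<infinity>\<close>, with leading coefficient exactly \<open>1\<close>; with
  this normalisation the relation is stable under products and inverses.
\<close>

definition asymp_v :: "int \<Rightarrow> Qv \<Rightarrow> bool" where
  "asymp_v e x \<longleftrightarrow> v powi (- e) * x - 1 \<in> vanishing_at_infinity"

lemma asymp_v_nonzero: "asymp_v e x \<Longrightarrow> x \<noteq> 0"
  using vanishing_uminus[of "- 1"] of_nat_vanishing_iff[of 1] by (auto simp: asymp_v_def)

lemma asymp_v_power_int [simp]: "asymp_v e (v powi e)"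
  by (simp add: asymp_v_def flip: power_int_add)

lemma asymp_v_1 [simp]: "asymp_v 0 1"
  by (simp add: asymp_v_def)

lemma asymp_v_mult:
  assumes "asymp_v e x" "asymp_v f y"
  shows "asymp_v (e + f) (x * y)"
proof -
  let ?x = "v powi (- e) * x" and ?y = "v powi (- f) * y"
  have "(?x - 1) * (?y - 1) + ((?x - 1) + (?y - 1)) \<in> vanishing_at_infinity"
    using assms unfolding asymp_v_def by (intro vanishing_add vanishing_mult)
  also have "(?x - 1) * (?y - 1) + ((?x - 1) + (?y - 1)) = v powi (- (e + f)) * (x * y) - 1"
    by (simp add: algebra_simps power_int_diff power_int_minus field_simps power_int_add)
  finally show ?thesis by (simp add: asymp_v_def)
qed

lemma asymp_v_inverse:
  assumes "asymp_v e x"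
  shows "asymp_v (- e) (inverse x)"
proof -
  define y where "y = v powi (- e) * x"
  obtain p q where *: "y - 1 = Fract p q" "degree p < degree q"
    using assms by (auto simp: asymp_v_def y_def vanishing_at_infinity_def)
  then have q: "q \<noteq> 0" by auto
  have deg: "degree (p + q) = degree q" using * by (simp add: degree_add_eq_right)
  then have pq: "p + q \<noteq> 0" using * by auto
  have "y = 1 + Fract p q" using * by (simp add: algebra_simps)
  also have "\<dots> = Fract (p + q) q" using q by (simp add: One_fract_def add.commute)
  finally have "inverse y = Fract q (p + q)" by simp
  then have "inverse y - 1 = Fract (- p) (p + q)"
    using pq q by (simp add: One_fract_def)
  moreover have "degree (- p) < degree (p + q)" using * deg by simp
  ultimately have "inverse y - 1 \<in> vanishing_at_infinity"
    unfolding vanishing_at_infinity_def by blast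
  then show ?thesis by (simp add: asymp_v_def y_def power_int_minus)
qed

lemma asymp_v_divide: "asymp_v e x \<Longrightarrow> asymp_v f y \<Longrightarrow> asymp_v (e - f) (x / y)"
  using asymp_v_mult[OF _ asymp_v_inverse, of e x f y] by (simp add: divide_inverse)

lemma asymp_v_negative_vanishing:
  assumes "asymp_v e x" "e < 0"
  shows "x \<in> vanishing_at_infinity"
proof -
  have "v powi e * (v powi (- e) * x - 1) + v powi e \<in> vanishing_at_infinity"
    using assms by (auto simp: asymp_v_def intro!: vanishing_add vanishing_mult power_int_v_vanishing)
  also have "v powi e * (v powi (- e) * x - 1) + v powi e = x"
    by (simp add: algebra_simps power_int_minus)
  finally show ?thesis .
qed

lemma asymp_v_add_lower:
  assumes "asymp_v e x" "asymp_v f y" "f < e"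
  shows "asymp_v e (x + y)" "asymp_v e (x - y)"
proof -
  have y: "v powi (- e) * y \<in> vanishing_at_infinity"
    using asymp_v_negative_vanishing[OF asymp_v_mult[OF asymp_v_power_int[of "- e"] assms(2)]] assms(3)
    by simp
  from assms(1) have x: "v powi (- e) * x - 1 \<in> vanishing_at_infinity" by (simp add: asymp_v_def)
  have "v powi (- e) * (x + y) - 1 = (v powi (- e) * x - 1) + v powi (- e) * y"
    "v powi (- e) * (x - y) - 1 = (v powi (- e) * x - 1) - v powi (- e) * y"
    by (simp_all add: algebra_simps)
  then show "asymp_v e (x + y)" "asymp_v e (x - y)"
    using vanishing_add[OF x y] vanishing_diff[OF x y] unfolding asymp_v_def by metis+
qed

lemma asymp_v_qint:
  assumes "n > 0" shows "asymp_v (int n - 1) (qint n)"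
proof -
  have "asymp_v (int m) (v ^ m - inverse v ^ m)" if "m > 0" for m
    using asymp_v_add_lower(2)[of "int m" "v ^ m" "- int m" "inverse v ^ m"]
      asymp_v_power_int[of "int m"] asymp_v_power_int[of "- int m"] that
    by (simp add: power_int_minus power_inverse)
  from asymp_v_divide[OF this[OF assms] this[of 1]] show ?thesis by (simp add: qint_def)
qed

lemma qint_nonzero: "n > 0 \<Longrightarrow> qint n \<noteq> 0"
  using asymp_v_qint asymp_v_nonzero by blast

text \<open>
  Leading coefficients equal to \<open>1\<close> cannot cancel: the coefficient of \<open>v\<^sup>M\<close> counts the summands that
  reach the maximal exponent.
\<close>

lemma leading_term_sum:
  assumes "finite S" "\<And>s. s \<in> S \<Longrightarrow> asymp_v (e s) (f s)" "\<And>s. s \<in> S \<Longrightarrow> e s \<le> M"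
  shows "v powi (- M) * sum f S - of_nat (card {s \<in> S. e s = M}) \<in> vanishing_at_infinity"
proof -
  have "(\<Sum>s\<in>S. v powi (- M) * f s - (if e s = M then 1 else 0)) \<in> vanishing_at_infinity"
  proof (rule vanishing_sum)
    fix s assume s: "s \<in> S"
    show "v powi (- M) * f s - (if e s = M then 1 else 0) \<in> vanishing_at_infinity"
    proof (cases "e s = M")
      case True
      then show ?thesis using assms(2)[OF s] by (simp add: asymp_v_def)
    next
      case False
      then have "e s < M" using assms(3)[OF s] by simp
      then have "v powi (- M) * f s \<in> vanishing_at_infinity"
        using asymp_v_negative_vanishing[OF asymp_v_mult[OF asymp_v_power_int[of "- M"] assms(2)[OF s]]]
        by simp
      then show ?thesis using False by simp
    qed
  qed
  also have "(\<Sum>s\<in>S. v powi (- M) * f s - (if e s = M then 1 else 0))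
      = v powi (- M) * sum f S - of_nat (card {s \<in> S. e s = M})"
    using assms(1) by (simp add: sum_subtractf sum_distrib_left sum.If_cases Int_def)
  finally show ?thesis .
qed

text \<open>
  The counting argument that makes the norm criterion an equivalence.  A second summand of exponent
  \<open>\<ge> 0\<close> would either raise the order of the sum above \<open>0\<close> or its constant term above \<open>1\<close>.
\<close>

lemma sum_asymptotic_to_1_iff:
  assumes "finite S" "\<And>s. s \<in> S \<Longrightarrow> asymp_v (e s) (f s)" "t \<in> S" "e t = 0"
  shows "sum f S - 1 \<in> vanishing_at_infinity \<longleftrightarrow> (\<forall>s\<in>S - {t}. e s < 0)"
proof
  assume neg: "\<forall>s\<in>S - {t}. e s < 0"
  then have "e s \<le> 0" if "s \<in> S" for s
    using that assms(4) by (cases "s = t") (auto intro: less_imp_le)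
  from leading_term_sum[OF assms(1,2) this]
  have "sum f S - of_nat (card {s \<in> S. e s = 0}) \<in> vanishing_at_infinity" by simp
  also have "{s \<in> S. e s = 0} = {t}" using neg assms by force
  finally show "sum f S - 1 \<in> vanishing_at_infinity" by simp
next
  assume L: "sum f S - 1 \<in> vanishing_at_infinity"
  define M where "M = Max (e ` S)"
  have le: "e s \<le> M" if "s \<in> S" for s using that assms(1) by (simp add: M_def)
  let ?T = "{s \<in> S. e s = M}"
  have "M \<in> e ` S" unfolding M_def using assms by (intro Max_in) auto
  then have T: "?T \<noteq> {}" by auto
  have fin: "finite ?T" using assms(1) by simp
  have lt: "v powi (- M) * sum f S - of_nat (card ?T) \<in> vanishing_at_infinity"
    by (rule leading_term_sum[OF assms(1,2) le])
  have "M \<ge> 0" using le[OF assms(3)] assms(4) by simp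
  have M: "M = 0"
  proof (rule ccontr)
    assume "M \<noteq> 0"
    then have "v powi (- M) \<in> vanishing_at_infinity"
      using \<open>M \<ge> 0\<close> by (intro power_int_v_vanishing) simp
    then have "v powi (- M) * (sum f S - 1) + v powi (- M) \<in> vanishing_at_infinity"
      using L by (intro vanishing_add vanishing_mult)
    then have "v powi (- M) * sum f S \<in> vanishing_at_infinity" by (simp add: algebra_simps)
    from vanishing_diff[OF this lt] have "of_nat (card ?T) \<in> vanishing_at_infinity" by simp
    then show False using T fin by (simp add: of_nat_vanishing_iff)
  qed
  have "card ?T \<ge> 1" using T fin by (simp add: Suc_le_eq card_gt_0_iff)
  moreover have "of_nat (card ?T) - 1 \<in> vanishing_at_infinity"
    using vanishing_diff[OF L lt] M by simp
  ultimately have "of_nat (card ?T - 1) \<in> vanishing_at_infinity" by (simp add: of_nat_diff)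
  then have "card ?T - 1 = 0" by (simp only: of_nat_vanishing_iff)
  then have "card ?T = 1" using \<open>card ?T \<ge> 1\<close> by simp
  then obtain u where "?T = {u}" by (auto simp: card_1_singleton_iff)
  moreover have "t \<in> ?T" using assms M by simp
  ultimately have "?T = {t}" by auto
  then show "\<forall>s\<in>S - {t}. e s < 0" using le M by force
qed

section \<open>Gaussian binomial coefficients\<close>

text \<open>
  The bar-invariant Gaussian binomial coefficients, defined by one of their two Pascal recursions:
  this recursion is the form in which they arise from the Leibniz rule below, and it yields their
  leading terms directly.
\<close>

fun qbinom :: "nat \<Rightarrow> nat \<Rightarrow> Qv" where
  "qbinom n 0 = 1"
| "qbinom 0 (Suc k) = 0"
| "qbinom (Suc n) (Suc k) = inverse v ^ Suc k * qbinom n (Suc k) + v powi (int n - int k) * qbinom n k"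

lemma qbinom_eq_0: "n < k \<Longrightarrow> qbinom n k = 0"
  by (induction n k rule: qbinom.induct) auto

lemma qbinom_self [simp]: "qbinom n n = 1"
  by (induction n) (auto simp: qbinom_eq_0)

lemma asymp_v_qbinom: "k \<le> n \<Longrightarrow> asymp_v (int k * (int n - int k)) (qbinom n k)"
proof (induction n k rule: qbinom.induct)
  case (3 n k)
  have B: "asymp_v (int (Suc k) * (int (Suc n) - int (Suc k))) (v powi (int n - int k) * qbinom n k)"
    using asymp_v_mult[OF asymp_v_power_int[of "int n - int k"] 3(2)] 3(3)
    by (simp add: algebra_simps)
  \<comment> \<open>The second summand of the recursion dominates by the factor \<open>v\<close> to the power \<open>2 (k + 1)\<close>.\<close>
  show ?case
  proof (cases "Suc k \<le> n")
    case True
    have "asymp_v (- int (Suc k) + int (Suc k) * (int n - int (Suc k)))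
        (v powi (- int (Suc k)) * qbinom n (Suc k))"
      by (intro asymp_v_mult asymp_v_power_int 3(1) True)
    moreover have "v powi (- int (Suc k)) = inverse v ^ Suc k"
      by (simp only: power_int_minus power_int_of_nat power_inverse)
    ultimately have A: "asymp_v (int (Suc k) * (int n - int (Suc k)) - int (Suc k))
        (inverse v ^ Suc k * qbinom n (Suc k))"
      by (simp only: add.commute diff_conv_add_uminus)
    have "int (Suc k) * (int n - int (Suc k)) - int (Suc k) < int (Suc k) * (int (Suc n) - int (Suc k))"
      by (simp add: algebra_simps)
    from asymp_v_add_lower(1)[OF B A this] show ?thesis by (simp add: add.commute)
  next
    case False
    then show ?thesis using B by (simp add: qbinom_eq_0)
  qed
qed auto

section \<open>Skew derivations and divided powers\<close>

interpretation U: vector_space scale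
  by (rule vector_space_scale)

lemma skew_add: "skew i (x + y) = skew i x + skew i y"
  by transfer (simp add: fskew_add serre_ideal.zero)

lemma skew_scale: "skew i (c \<cdot> x) = c \<cdot> skew i x"
  unfolding scale_def by transfer (simp add: fskew_fconst_mult serre_ideal.zero)

lemma skew_0 [simp]: "skew i 0 = 0"
  using skew_scale[of i 0 0] by simp

lemma skew_1 [simp]: "skew i 1 = 0"
proof (transfer)
  fix i
  show "fskew i 1 - 0 \<in> serre_ideal"
    using fskew_single[of i "[]" 1] by (simp add: single_Nil serre_ideal.zero)
qed

lemma skew_sum: "skew i (sum f A) = (\<Sum>x\<in>A. skew i (f x))"
  by (induction A rule: infinite_finite_induct) (simp_all add: skew_add)

lemmas scale_mult = scale_mult_left scale_mult_right

lemma form_add_right: "form x (y + z) = form x y + form x z"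
  using form_add_left[of y z x] by (simp add: form_sym)

lemma form_scale_right: "form x (c \<cdot> y) = c * form x y"
  using form_scale_left[of c y x] by (simp add: form_sym)

lemma form_0_right [simp]: "form x 0 = 0"
  using form_scale_right[of x 0 0] by simp

lemma form_sum_right: "form x (sum f A) = (\<Sum>y\<in>A. form x (f y))"
  by (induction A rule: infinite_finite_induct) (simp_all add: form_add_right)

lemma Uplus_induct [case_names one gen add scale]:
  assumes "P 1" "\<And>j x. P x \<Longrightarrow> P (E j * x)" "\<And>x y. P x \<Longrightarrow> P y \<Longrightarrow> P (x + y)" "\<And>c x. P x \<Longrightarrow> P (c \<cdot> x)"
  shows "P x"
proof (induction x rule: Uplus.abs_induct)
  case (1 p)
  have abs_mult: "abs_Uplus (x * y) = abs_Uplus x * abs_Uplus y" for x y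
    by (simp add: times_Uplus.abs_eq)
  have word: "P (abs_Uplus (Poly_Mapping.single (Word u) 1))" for u
  proof (induction u)
    case Nil
    then show ?case using assms(1) by (simp add: single_Nil one_Uplus.abs_eq)
  next
    case (Cons i u)
    then show ?case using assms(2) by (simp add: single_Cons abs_mult E.abs_eq)
  qed
  show ?case
  proof (induction p rule: free_alg_induct)
    case zero
    then show ?case using assms(4)[OF assms(1), of 0] by (simp add: zero_Uplus.abs_eq)
  next
    case (single w c)
    obtain u where w: "w = Word u" by (cases w)
    have "Poly_Mapping.single w c = fconst c * Poly_Mapping.single (Word u) 1"
      by (simp add: w fconst_single)
    then have "abs_Uplus (Poly_Mapping.single w c) = c \<cdot> abs_Uplus (Poly_Mapping.single (Word u) 1)"
      by (simp add: abs_mult scale_def const.abs_eq)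
    then show ?case using assms(4)[OF word] by simp
  next
    case (add x y)
    then show ?case using assms(3) by (simp flip: plus_Uplus.abs_eq)
  qed
qed

lemma divpow_0 [simp]: "divpow i 0 = 1"
  by (simp add: divpow_def qfact_def)

lemma divpow_Suc: "divpow i (Suc n) = inverse (qint (Suc n)) \<cdot> (E i * divpow i n)"
  by (simp add: divpow_def qfact_def scale_mult mult.commute)

lemma divpow_commute_E: "divpow i n * E i = E i * divpow i n"
  by (simp add: divpow_def scale_mult power_commutes)

lemma E_mult_divpow: "E i * divpow i n = qint (Suc n) \<cdot> divpow i (Suc n)"
  by (simp add: divpow_Suc qint_nonzero)

lemma qint_Suc_rec: "qint (Suc n) = v ^ n + inverse v * qint n" "qint (Suc n) = inverse v ^ n + v * qint n"
proof -
  have "(v - inverse v) * v ^ n + inverse v * (v ^ n - inverse v ^ n) = v ^ Suc n - inverse v ^ Suc n"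
    "(v - inverse v) * inverse v ^ n + v * (v ^ n - inverse v ^ n) = v ^ Suc n - inverse v ^ Suc n"
    by (simp_all add: algebra_simps del: left_inverse right_inverse)
  then show "qint (Suc n) = v ^ n + inverse v * qint n" "qint (Suc n) = inverse v ^ n + v * qint n"
    using v_diff_nonzero unfolding qint_def by (simp_all add: field_simps)
qed

lemma skew_divpow_other: "i \<noteq> j \<Longrightarrow> skew i (divpow j m * y) = v powi (- 2 * int m) \<cdot> (divpow j m * skew i y)"
proof (induction m arbitrary: y)
  case (Suc m)
  then show ?case
    by (simp add: divpow_Suc scale_mult skew_scale skew_E_mult mult.assoc cartan_def
        algebra_simps flip: power_int_add)
qed simp

text \<open>
  The divided power \<open>E\<^sub>i\<^bsup>(m - k)\<^esup>\<close>, read as \<open>0\<close> when \<open>k > m\<close>.  With this convention the Leibniz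
  rules hold without case distinctions at the boundary.
\<close>

definition divpow_drop :: "node \<Rightarrow> nat \<Rightarrow> nat \<Rightarrow> Uplus" where
  "divpow_drop i m k = (if k \<le> m then divpow i (m - k) else 0)"

lemma skew_divpow:
  "skew i (divpow i m * y) = v powi (int m - 1) \<cdot> (divpow_drop i m 1 * y) + v powi (2 * int m) \<cdot> (divpow i m * skew i y)"
proof (induction m)
  case 0
  show ?case by (simp add: divpow_drop_def)
next
  case (Suc m)
  let ?q = "inverse (qint (Suc m))"
  have "E i * divpow_drop i m 1 = qint m \<cdot> divpow i m"
    by (cases m) (auto simp: divpow_drop_def E_mult_divpow qint_def)
  then have E: "E i * (divpow_drop i m 1 * z) = qint m \<cdot> (divpow i m * z)"
    "E i * (divpow i m * z) = qint (Suc m) \<cdot> (divpow i (Suc m) * z)" for z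
    by (simp_all add: E_mult_divpow scale_mult flip: mult.assoc)
  have "skew i (divpow i (Suc m) * y) = ?q \<cdot> (divpow i m * y + v ^ 2 \<cdot> (E i * skew i (divpow i m * y)))"
    by (simp add: divpow_Suc scale_mult skew_scale skew_E_mult mult.assoc cartan_def)
  also have "E i * skew i (divpow i m * y) = (v powi (int m - 1) * qint m) \<cdot> (divpow i m * y)
      + (v powi (2 * int m) * qint (Suc m)) \<cdot> (divpow i (Suc m) * skew i y)"
    by (simp add: Suc.IH distrib_left scale_mult E del: One_nat_def)
  also have "?q \<cdot> (divpow i m * y + v ^ 2 \<cdot> \<dots>) = (?q * (1 + v ^ 2 * v powi (int m - 1) * qint m)) \<cdot> (divpow i m * y)
      + (?q * v ^ 2 * v powi (2 * int m) * qint (Suc m)) \<cdot> (divpow i (Suc m) * skew i y)"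
    by (simp add: U.scale_right_distrib U.scale_left_distrib distrib_left mult.assoc)
  also have "1 + v ^ 2 * v powi (int m - 1) * qint m = v ^ m * qint (Suc m)"
    unfolding qint_Suc_rec(2)
    by (simp add: distrib_left power_int_diff power2_eq_square power_inverse)
  also have "?q * v ^ 2 * v powi (2 * int m) * qint (Suc m) = v powi (2 * int (Suc m))"
    using qint_nonzero[of "Suc m"] by (simp add: power_int_add mult_ac)
  finally show ?case
    using qint_nonzero[of "Suc m"] by (simp add: divpow_drop_def)
qed

text \<open>
  The iterated skew derivation rescaled by \<open>v\<close> to the power \<open>- n (n - 1) / 2\<close>.  The rescaling removes
  all quadratic correction terms from the Leibniz rule and makes the adjunction constants \<open>kappa n\<close>
  of order \<open>0\<close>.
\<close>

primrec skew_pow :: "node \<Rightarrow> nat \<Rightarrow> Uplus \<Rightarrow> Uplus" where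
  "skew_pow i 0 x = x"
| "skew_pow i (Suc n) x = inverse v ^ n \<cdot> skew i (skew_pow i n x)"

lemma skew_skew_pow: "skew i (skew_pow i n x) = v ^ n \<cdot> skew_pow i (Suc n) x"
  by (simp flip: power_mult_distrib)

lemma skew_pow_add: "skew_pow i n (x + y) = skew_pow i n x + skew_pow i n y"
  by (induction n) (simp_all add: skew_add U.scale_right_distrib)

lemma skew_pow_scale: "skew_pow i n (c \<cdot> x) = c \<cdot> skew_pow i n x"
  by (induction n) (simp_all add: skew_scale mult.commute)

lemma skew_pow_0 [simp]: "skew_pow i n 0 = 0"
  using skew_pow_scale[of i n 0 0] by simp

lemma skew_pow_1: "skew_pow i n 1 = (if n = 0 then 1 else 0)"
  by (induction n) simp_all

lemma skew_pow_divpow_other: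
  "i \<noteq> j \<Longrightarrow> skew_pow i n (divpow j m * y) = v powi (- 2 * int m * int n) \<cdot> (divpow j m * skew_pow i n y)"
proof (induction n)
  case (Suc n)
  have "v powi (- 2 * int m * int (Suc n)) = v powi (- 2 * int m) * v powi (- 2 * int m * int n)"
    by (simp add: algebra_simps flip: power_int_add)
  then show ?case
    using Suc by (simp add: skew_scale skew_divpow_other scale_mult mult_ac)
qed simp

lemma skew_divpow_drop:
  "skew i (divpow_drop i m k * y) = v powi (int m - int k - 1) \<cdot> (divpow_drop i m (Suc k) * y)
     + v powi (2 * (int m - int k)) \<cdot> (divpow_drop i m k * skew i y)"
proof (cases "k \<le> m")
  case True
  then have "divpow_drop i (m - k) 1 = divpow_drop i m (Suc k)" by (auto simp: divpow_drop_def)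
  then show ?thesis
    using skew_divpow[of i "m - k" y] True by (simp add: divpow_drop_def of_nat_diff)
next
  case False
  then show ?thesis by (simp add: divpow_drop_def)
qed

text \<open>
  The quantum Leibniz rule: \<open>k\<close> of the \<open>n\<close> derivations hit the divided power, the others pass it at
  the price of a power of \<open>v\<close>.  In the induction step the two terms of the one-step rule are
  collected according to the number of factors removed; their coefficients combine by the Pascal
  recursion of \<open>qbinom\<close>.
\<close>

proposition skew_pow_divpow:
  "skew_pow i n (divpow i m * y) = (\<Sum>k\<le>n. (qbinom n k * v powi ((int m - int k) * (2 * int n - int k)))
     \<cdot> (divpow_drop i m k * skew_pow i (n - k) y))"
proof (induction n)
  case 0
  show ?case by (simp add: divpow_drop_def)
next
  case (Suc n)
  let ?P = "\<lambda>n k. v powi ((int m - int k) * (2 * int n - int k))"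
  let ?t = "\<lambda>k. divpow_drop i m k * skew_pow i (Suc n - k) y"
  have "inverse v ^ n \<cdot> skew i ((qbinom n k * ?P n k) \<cdot> (divpow_drop i m k * skew_pow i (n - k) y))
      = (inverse v ^ k * qbinom n k * ?P (Suc n) k) \<cdot> ?t k
        + (v powi (int n - int k) * qbinom n k * ?P (Suc n) (Suc k)) \<cdot> ?t (Suc k)" (is "?l = _")
    if "k \<le> n" for k
  proof -
    have i: "inverse v ^ l = v powi (- int l)" "v ^ l = v powi int l" for l
      by (simp_all add: power_int_minus power_inverse)
    have e: "inverse v ^ n * (?P n k * (v powi (2 * (int m - int k)) * v ^ (n - k)))
        = inverse v ^ k * ?P (Suc n) k"
      "inverse v ^ n * (?P n k * v powi (int m - int k - 1))
        = v powi (int n - int k) * ?P (Suc n) (Suc k)"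
      unfolding i using that
      by (simp_all only: power_int_add[symmetric] v_nonzero simp_thms of_nat_diff)
         (simp_all add: algebra_simps)
    have s: "skew i (skew_pow i (n - k) y) = v ^ (n - k) \<cdot> skew_pow i (Suc n - k) y"
      using that by (simp add: skew_skew_pow Suc_diff_le del: skew_pow.simps)
    have "?l = (qbinom n k * (inverse v ^ n * (?P n k * (v powi (2 * (int m - int k)) * v ^ (n - k))))) \<cdot> ?t k
        + (qbinom n k * (inverse v ^ n * (?P n k * v powi (int m - int k - 1)))) \<cdot> ?t (Suc k)"
      by (simp add: skew_scale skew_divpow_drop s scale_mult U.scale_right_distrib mult_ac add_ac del: skew_pow.simps)
    then show ?thesis unfolding e by (simp add: mult_ac)
  qed
  then have "skew_pow i (Suc n) (divpow i m * y) = (\<Sum>k\<le>n. (inverse v ^ k * qbinom n k * ?P (Suc n) k) \<cdot> ?t k)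
      + (\<Sum>k\<le>n. (v powi (int n - int k) * qbinom n k * ?P (Suc n) (Suc k)) \<cdot> ?t (Suc k))"
    by (simp add: Suc.IH skew_sum U.scale_sum_right sum.distrib)
  also have "(\<Sum>k\<le>n. (inverse v ^ k * qbinom n k * ?P (Suc n) k) \<cdot> ?t k)
      = (\<Sum>k\<le>Suc n. (inverse v ^ k * qbinom n k * ?P (Suc n) k) \<cdot> ?t k)"
    by (simp add: qbinom_eq_0)
  also have "\<dots> = ?P (Suc n) 0 \<cdot> ?t 0 + (\<Sum>k\<le>n. (inverse v ^ Suc k * qbinom n (Suc k) * ?P (Suc n) (Suc k)) \<cdot> ?t (Suc k))"
    by (subst sum.atMost_Suc_shift) simp
  finally have "skew_pow i (Suc n) (divpow i m * y) = ?P (Suc n) 0 \<cdot> ?t 0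
      + (\<Sum>k\<le>n. (qbinom (Suc n) (Suc k) * ?P (Suc n) (Suc k)) \<cdot> ?t (Suc k))"
    by (simp only: add.assoc sum.distrib[symmetric] U.scale_left_distrib[symmetric] distrib_right[symmetric] qbinom.simps)
  also have "\<dots> = (\<Sum>k\<le>Suc n. (qbinom (Suc n) k * ?P (Suc n) k) \<cdot> ?t k)"
    by (subst sum.atMost_Suc_shift) simp
  finally show ?case .
qed

lemma skew_pow_divpow_annihilated:
  assumes "\<And>l. l > 0 \<Longrightarrow> skew_pow i l y = 0"
  shows "skew_pow i n (divpow i m * y) = v powi ((int m - int n) * int n) \<cdot> (divpow_drop i m n * y)"
proof -
  have "skew_pow i n (divpow i m * y) = (\<Sum>k\<le>n. if k = n then v powi ((int m - int n) * int n) \<cdot> (divpow_drop i m n * y) else 0)"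
    unfolding skew_pow_divpow by (rule sum.cong) (use assms in auto)
  then show ?thesis by simp
qed

text \<open>
  If the right factor is annihilated by more than \<open>n - m\<close> derivations, all \<open>m\<close> factors \<open>E\<^sub>i\<close> on the left
  have to be removed, so only one term of the Leibniz rule survives.
\<close>

lemma skew_pow_divpow_top:
  assumes "\<And>l. l > n - m \<Longrightarrow> skew_pow i l y = 0" "m \<le> n"
  shows "skew_pow i n (divpow i m * y) = qbinom n m \<cdot> skew_pow i (n - m) y"
proof -
  have "skew_pow i n (divpow i m * y) = (\<Sum>k\<le>n. if k = m then qbinom n m \<cdot> skew_pow i (n - m) y else 0)"
    unfolding skew_pow_divpow
  proof (rule sum.cong)
    fix k assume "k \<in> {..n}"
    then have "k < m \<Longrightarrow> skew_pow i (n - k) y = 0" using assms by auto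
    then show "(qbinom n k * v powi ((int m - int k) * (2 * int n - int k))) \<cdot> (divpow_drop i m k * skew_pow i (n - k) y)
      = (if k = m then qbinom n m \<cdot> skew_pow i (n - m) y else 0)"
      by (cases k m rule: linorder_cases) (auto simp: divpow_drop_def)
  qed simp
  then show ?thesis using assms(2) by simp
qed

lemma skew_pow_divpow_reversed:
  "skew_pow i n (divpow i n * y) = (\<Sum>x\<le>n. (qbinom n (n - x) * v powi (int x * (int n + int x)))
     \<cdot> (divpow i x * skew_pow i x y))"
  unfolding skew_pow_divpow
  by (rule sum.reindex_bij_witness[of _ "\<lambda>x. n - x" "\<lambda>x. n - x"])
     (auto simp: divpow_drop_def of_nat_diff algebra_simps)

text \<open>
  The norm of \<open>E\<^sub>i\<^bsup>(n)\<^esup>\<close>, that is, the product of \<open>1 / (1 - v\<^bsup>-2s\<^esup>)\<close> over \<open>1 \<le> s \<le> n\<close>; written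
  here in the form in which its factors occur in the adjunction.
\<close>

primrec kappa :: "nat \<Rightarrow> Qv" where
  "kappa 0 = 1"
| "kappa (Suc n) = kappa n * (inverse (1 - inverse v ^ 2) * v ^ n / qint (Suc n))"

lemma form_divpow_left: "form (divpow i n * z) w = kappa n * form z (skew_pow i n w)"
proof (induction n arbitrary: z)
  case (Suc n)
  have "divpow i (Suc n) * z = inverse (qint (Suc n)) \<cdot> (divpow i n * (E i * z))"
    by (simp add: divpow_Suc scale_mult divpow_commute_E flip: mult.assoc)
  then show ?case
    by (simp add: form_scale_left Suc.IH form_E_left skew_skew_pow form_scale_right divide_inverse del: skew_pow.simps)
qed simp

lemma asymp_v_kappa: "asymp_v 0 (kappa n)"
proof (induction n)
  case (Suc n)
  have "asymp_v 0 (1 - v powi - 2)"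
    using asymp_v_add_lower(2)[OF asymp_v_1 asymp_v_power_int[of "- 2"]] by simp
  then have "asymp_v 0 (inverse (1 - inverse v ^ 2))"
    using asymp_v_inverse[of 0] by (simp add: power_int_minus power_inverse)
  from asymp_v_divide[OF asymp_v_mult[OF this asymp_v_power_int[of "int n"]] asymp_v_qint[of "Suc n"]]
  have "asymp_v 0 (inverse (1 - inverse v ^ 2) * v ^ n / qint (Suc n))" by simp
  from asymp_v_mult[OF Suc this] show ?case by simp
qed simp

section \<open>The norm of a monomial with four factors\<close>

abbreviation monomial4 :: "node \<Rightarrow> node \<Rightarrow> nat \<Rightarrow> nat \<Rightarrow> nat \<Rightarrow> nat \<Rightarrow> Uplus" where
  "monomial4 i j a b c d \<equiv> divpow i a * (divpow j b * (divpow i c * divpow j d))"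

lemma skew_pow_divpow_alone: "i \<noteq> j \<Longrightarrow> l > 0 \<Longrightarrow> skew_pow i l (divpow j d) = 0"
  using skew_pow_divpow_other[of i j l d 1] by (simp add: skew_pow_1)

lemma skew_pow_divpow_self: "skew_pow i n (divpow i n) = 1"
  using skew_pow_divpow_annihilated[of i 1 n n] by (simp add: skew_pow_1 divpow_drop_def)

lemma skew_pow_two_factors:
  assumes "i \<noteq> j"
  shows "skew_pow i n (divpow i c * divpow j d) = v powi ((int c - int n) * int n) \<cdot> (divpow_drop i c n * divpow j d)"
  by (rule skew_pow_divpow_annihilated) (rule skew_pow_divpow_alone[OF assms])

lemma skew_pow_three_factors:
  assumes "i \<noteq> j"
  shows "skew_pow i n (divpow j b * (divpow i c * divpow j d))
    = v powi ((int c - int n) * int n - 2 * int b * int n) \<cdot> (divpow j b * (divpow_drop i c n * divpow j d))"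
  by (simp add: skew_pow_divpow_other[OF assms] skew_pow_two_factors[OF assms] scale_mult add.commute
      flip: power_int_add)

lemma form_one_factor: "y \<le> d \<Longrightarrow> form (divpow j d) (divpow j y * divpow j (d - y)) = kappa d * qbinom d y"
proof -
  assume y: "y \<le> d"
  have "skew_pow j d (divpow j y * divpow j (d - y)) = qbinom d y \<cdot> skew_pow j (d - y) (divpow j (d - y))"
  proof (rule skew_pow_divpow_top[OF _ y])
    show "skew_pow j l (divpow j (d - y)) = 0" if "d - y < l" for l
      using skew_pow_divpow_annihilated[of j 1 l "d - y"] that by (simp add: skew_pow_1 divpow_drop_def)
  qed
  then show ?thesis
    using form_divpow_left[of j d 1 "divpow j y * divpow j (d - y)"]
    by (simp add: skew_pow_divpow_self form_scale_right form_1_1)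
qed

text \<open>
  Together with \<open>form_three_factors\<close> and \<open>norm_four_factors\<close>, this strips the left argument of one
  divided power at a time by adjunction.  Here \<open>x\<close> and \<open>y\<close> count how many of
  the factors removed by the first two adjunctions come from the later block of the same letter.
\<close>

lemma form_two_factors:
  assumes "i \<noteq> j" "x \<le> c" "y \<le> d"
  shows "form (divpow i c * divpow j d) (monomial4 i j x y (c - x) (d - y))
    = kappa c * kappa d * qbinom c x * qbinom d y * v powi (- 2 * int y * (int c - int x))"
proof -
  have "skew_pow i c (monomial4 i j x y (c - x) (d - y))
      = qbinom c x \<cdot> skew_pow i (c - x) (divpow j y * (divpow i (c - x) * divpow j (d - y)))"
    using assms by (intro skew_pow_divpow_top) (auto simp: skew_pow_three_factors divpow_drop_def)
  also have "\<dots> = (qbinom c x * v powi (- 2 * int y * (int c - int x))) \<cdot> (divpow j y * divpow j (d - y))"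
    using assms by (simp add: skew_pow_three_factors divpow_drop_def of_nat_diff)
  finally show ?thesis
    using assms by (simp add: form_divpow_left form_scale_right form_one_factor mult_ac)
qed

lemma form_three_factors:
  assumes "i \<noteq> j" "x \<le> c"
  shows "form (divpow j b * (divpow i c * divpow j d)) (monomial4 i j x b (c - x) d)
    = (\<Sum>y\<le>min b d. kappa b * kappa c * kappa d * qbinom b (b - y) * qbinom c x * qbinom d y *
        v powi (- 2 * int x * int b + int y * (int b + int d - 4 * int c + 4 * int x)))"
    (is "_ = (\<Sum>y\<le>_. ?f y)")
proof -
  note ji = assms(1)[symmetric]
  have "skew_pow j b (monomial4 i j x b (c - x) d)
     = v powi (- 2 * int x * int b) \<cdot> (divpow i x * (\<Sum>y\<le>b. (qbinom b (b - y) * v powi (int y * (int b + int y)))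
        \<cdot> (divpow j y * skew_pow j y (divpow i (c - x) * divpow j d))))"
    by (simp add: skew_pow_divpow_other[OF ji] skew_pow_divpow_reversed)
  also have "\<dots> = (\<Sum>y\<le>b. (v powi (- 2 * int x * int b) * qbinom b (b - y) * v powi (int y * (int b + int y))
        * v powi ((int d - int y) * int y - 2 * (int c - int x) * int y))
        \<cdot> (divpow i x * (divpow j y * (divpow i (c - x) * divpow_drop j d y))))"
    using assms skew_pow_three_factors[OF ji, of _ "c - x" d 0]
    by (simp add: sum_distrib_left scale_mult U.scale_sum_right of_nat_diff mult.assoc)
  finally have *: "form (divpow j b * (divpow i c * divpow j d)) (monomial4 i j x b (c - x) d)
    = (\<Sum>y\<le>b. kappa b * (v powi (- 2 * int x * int b) * qbinom b (b - y) * v powi (int y * (int b + int y))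
        * v powi ((int d - int y) * int y - 2 * (int c - int x) * int y))
      * form (divpow i c * divpow j d) (divpow i x * (divpow j y * (divpow i (c - x) * divpow_drop j d y))))"
    by (simp add: form_divpow_left form_sum_right form_scale_right sum_distrib_left mult.assoc)
  also have "\<dots> = (\<Sum>y\<le>min b d. ?f y)"
  proof (rule sum.mono_neutral_cong_right)
    fix y assume y: "y \<in> {..min b d}"
    have e: "?f y = kappa b * kappa c * kappa d * qbinom b (b - y) * qbinom c x * qbinom d y *
       (v powi (- 2 * int x * int b) * v powi (int y * (int b + int y))
        * v powi ((int d - int y) * int y - 2 * (int c - int x) * int y) * v powi (- 2 * int y * (int c - int x)))"
      by (simp add: algebra_simps flip: power_int_add)
    show "kappa b * (v powi (- 2 * int x * int b) * qbinom b (b - y) * v powi (int y * (int b + int y))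
        * v powi ((int d - int y) * int y - 2 * (int c - int x) * int y))
      * form (divpow i c * divpow j d) (divpow i x * (divpow j y * (divpow i (c - x) * divpow_drop j d y))) = ?f y"
      unfolding e using y assms by (simp add: divpow_drop_def form_two_factors mult_ac)
  qed (auto simp: divpow_drop_def)
  finally show ?thesis .
qed

lemma norm_four_factors:
  assumes "i \<noteq> j"
  shows "form (monomial4 i j a b c d) (monomial4 i j a b c d)
    = (\<Sum>(x, y)\<in>{..min a c} \<times> {..min b d}. kappa a * kappa b * kappa c * kappa d *
        qbinom a (a - x) * qbinom b (b - y) * qbinom c x * qbinom d y *
        v powi (int x * (int a + int c - 4 * int b) + int y * (int b + int d - 4 * int c + 4 * int x)))"
    (is "_ = (\<Sum>(x, y)\<in>_. ?f x y)")
proof -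
  let ?m = "divpow j b * (divpow i c * divpow j d)"
  let ?e = "\<lambda>x. int x * (int a + int x) + ((int c - int x) * int x - 2 * int b * int x)"
  let ?g = "\<lambda>x y. kappa b * kappa c * kappa d * qbinom b (b - y) * qbinom c x * qbinom d y *
        v powi (- 2 * int x * int b + int y * (int b + int d - 4 * int c + 4 * int x))"
  have "skew_pow i a (divpow i a * ?m) = (\<Sum>x\<le>a. (qbinom a (a - x) * v powi (?e x))
      \<cdot> (divpow i x * (divpow j b * (divpow_drop i c x * divpow j d))))"
    by (simp add: skew_pow_divpow_reversed skew_pow_three_factors[OF assms] scale_mult mult.assoc power_int_add)
  then have "form (divpow i a * ?m) (divpow i a * ?m) = (\<Sum>x\<le>a. kappa a * (qbinom a (a - x) * v powi (?e x))
      * form ?m (divpow i x * (divpow j b * (divpow_drop i c x * divpow j d))))"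
    by (simp add: form_divpow_left form_sum_right form_scale_right sum_distrib_left mult.assoc)
  also have "\<dots> = (\<Sum>x\<le>min a c. kappa a * (qbinom a (a - x) * v powi (?e x)) * (\<Sum>y\<le>min b d. ?g x y))"
  proof (rule sum.mono_neutral_cong_right)
    fix x assume x: "x \<in> {..min a c}"
    then show "kappa a * (qbinom a (a - x) * v powi (?e x))
        * form ?m (divpow i x * (divpow j b * (divpow_drop i c x * divpow j d)))
      = kappa a * (qbinom a (a - x) * v powi (?e x)) * (\<Sum>y\<le>min b d. ?g x y)"
      using form_three_factors[OF assms, of x c b d] by (simp add: divpow_drop_def)
  qed (auto simp: divpow_drop_def)
  also have "\<dots> = (\<Sum>x\<le>min a c. \<Sum>y\<le>min b d. ?f x y)"
    unfolding sum_distrib_left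
  proof (intro sum.cong refl)
    fix x y
    have "v powi (?e x) * v powi (- 2 * int x * int b + int y * (int b + int d - 4 * int c + 4 * int x))
      = v powi (int x * (int a + int c - 4 * int b) + int y * (int b + int d - 4 * int c + 4 * int x))"
      by (simp add: algebra_simps flip: power_int_add)
    then show "kappa a * (qbinom a (a - x) * v powi (?e x)) * ?g x y = ?f x y"
      by (simp add: mult_ac)
  qed
  finally show ?thesis by (simp add: sum.cartesian_product)
qed

text \<open>
  A Gaussian binomial \<open>[n, k]\<close> has leading term \<open>v\<^bsup>k(n - k)\<^esup>\<close>; adding these exponents to the explicit
  power of \<open>v\<close> in the norm formula gives \<open>-2\<close> times the quadratic function on the right.
\<close>

lemma norm_four_factors_asymptotic_to_1_iff:
  assumes "i \<noteq> j"
  shows "form (monomial4 i j a b c d) (monomial4 i j a b c d) - 1 \<in> vanishing_at_infinity \<longleftrightarrow>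
    (\<forall>x\<le>min a c. \<forall>y\<le>min b d. (x, y) \<noteq> (0, 0) \<longrightarrow>
      0 < int x * (2 * int b - int a - int c) + int y * (2 * int c - int b - int d) + (int x - int y)^2)"
proof -
  let ?Q = "\<lambda>(x, y). int x * (2 * int b - int a - int c) + int y * (2 * int c - int b - int d) + (int x - int y)^2"
  let ?S = "{..min a c} \<times> {..min b d}"
  let ?f = "\<lambda>(x, y). kappa a * kappa b * kappa c * kappa d *
        qbinom a (a - x) * qbinom b (b - y) * qbinom c x * qbinom d y *
        v powi (int x * (int a + int c - 4 * int b) + int y * (int b + int d - 4 * int c + 4 * int x))"
  have asymp: "asymp_v (- 2 * ?Q s) (?f s)" if s: "s \<in> ?S" for s
  proof -
    obtain x y where [simp]: "s = (x, y)" by (cases s)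
    have le: "a - x \<le> a" "b - y \<le> b" "x \<le> c" "y \<le> d" "x \<le> a" "y \<le> b" using s by auto
    let ?e = "int x * (int a + int c - 4 * int b) + int y * (int b + int d - 4 * int c + 4 * int x)"
    have "asymp_v (0 + 0 + 0 + 0 + int (a - x) * (int a - int (a - x)) + int (b - y) * (int b - int (b - y))
        + int x * (int c - int x) + int y * (int d - int y) + ?e) (?f s)"
      unfolding \<open>s = (x, y)\<close> prod.case
      by (intro asymp_v_mult asymp_v_kappa asymp_v_qbinom asymp_v_power_int le)
    moreover have "0 + 0 + 0 + 0 + int (a - x) * (int a - int (a - x)) + int (b - y) * (int b - int (b - y))
        + int x * (int c - int x) + int y * (int d - int y) + ?e = - 2 * ?Q s"
      using le by (simp add: of_nat_diff power2_eq_square algebra_simps)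
    ultimately show ?thesis by metis
  qed
  have "sum ?f ?S - 1 \<in> vanishing_at_infinity \<longleftrightarrow> (\<forall>s\<in>?S - {(0, 0)}. - 2 * ?Q s < 0)"
    by (rule sum_asymptotic_to_1_iff[OF _ asymp]) auto
  also have "\<dots> \<longleftrightarrow> (\<forall>x\<le>min a c. \<forall>y\<le>min b d. (x, y) \<noteq> (0, 0) \<longrightarrow> 0 < ?Q (x, y))"
    by force
  finally show ?thesis unfolding norm_four_factors[OF assms] by simp
qed

text \<open>
  Positivity of all four exponents puts \<open>(1, 0)\<close>, \<open>(0, 1)\<close> and \<open>(1, 1)\<close> into the range of \<open>(x, y)\<close>, and
  these three points give the inequalities.  Conversely, the square is positive off the diagonal, and
  on the diagonal the sum of the two nonnegative linear coefficients is positive.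
\<close>

lemma norm_four_positive_factors_asymptotic_to_1_iff:
  assumes "i \<noteq> j" "a > 0" "b > 0" "c > 0" "d > 0"
  shows "form (monomial4 i j a b c d) (monomial4 i j a b c d) - 1 \<in> vanishing_at_infinity \<longleftrightarrow>
    2 * b \<ge> a + c \<and> 2 * c \<ge> b + d \<and> (2 * b > a + c \<or> 2 * c > b + d)" (is "?L \<longleftrightarrow> ?R")
proof
  assume ?L
  then have *: "0 < int x * (2 * int b - int a - int c) + int y * (2 * int c - int b - int d) + (int x - int y)^2"
    if "x \<le> 1" "y \<le> 1" "(x, y) \<noteq> (0, 0)" for x y
  proof -
    have "x \<le> min a c" "y \<le> min b d" using that assms by auto
    then show ?thesis
      using \<open>?L\<close> that(3) unfolding norm_four_factors_asymptotic_to_1_iff[OF assms(1)] by blast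
  qed
  show ?R using *[of 1 0] *[of 0 1] *[of 1 1] by auto
next
  assume R: ?R
  define p q where "p = 2 * int b - int a - int c" and "q = 2 * int c - int b - int d"
  have pq: "p \<ge> 0" "q \<ge> 0" "p + q > 0" using R by (auto simp: p_def q_def)
  have "0 < int x * p + int y * q + (int x - int y)^2" if "(x, y) \<noteq> (0, 0)" for x y
  proof (cases "x = y")
    case True
    then have "0 < int x * (p + q)" using that pq by simp
    then show ?thesis using True by (simp add: distrib_left)
  next
    case False
    then have "0 < (int x - int y)^2" by simp
    moreover have "0 \<le> int x * p" "0 \<le> int y * q" using pq by simp_all
    ultimately show ?thesis by linarith
  qed
  then show ?L unfolding norm_four_factors_asymptotic_to_1_iff[OF assms(1)] p_def q_def by simp
qed

section \<open>Cancellation and left divisibility by a generator\<close>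

lemma skew_pow_E_mult:
  "skew_pow i n (E i * y) = v ^ (2 * n) \<cdot> (E i * skew_pow i n y) + qint n \<cdot> skew_pow i (n - 1) y"
proof (induction n)
  case 0
  show ?case by (simp add: qint_def)
next
  case (Suc n)
  have c: "inverse v ^ n * qint n * v ^ (n - 1) = inverse v * qint n"
    by (cases n) (auto simp: qint_def power_inverse)
  have d: "qint n \<cdot> skew i (skew_pow i (n - 1) y) = (qint n * v ^ (n - 1)) \<cdot> skew_pow i n y"
  proof (cases n)
    case (Suc m)
    then show ?thesis by (simp add: skew_skew_pow del: skew_pow.simps)
  qed (simp add: qint_def)
  have d': "skew i (qint n \<cdot> skew_pow i (n - 1) y) = (qint n * v ^ (n - 1)) \<cdot> skew_pow i n y"
    unfolding skew_scale by (rule d)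
  have "skew_pow i (Suc n) (E i * y) = inverse v ^ n \<cdot> skew i (v ^ (2 * n) \<cdot> (E i * skew_pow i n y) + qint n \<cdot> skew_pow i (n - 1) y)"
    by (simp add: Suc.IH)
  also have "\<dots> = (inverse v ^ n * v ^ (2 * n) * v ^ 2 * v ^ n) \<cdot> (E i * skew_pow i (Suc n) y)
      + (inverse v ^ n * v ^ (2 * n)) \<cdot> skew_pow i n y + (inverse v ^ n * qint n * v ^ (n - 1)) \<cdot> skew_pow i n y"
    unfolding skew_add d'
    unfolding skew_scale skew_E_mult skew_skew_pow
    by (simp add: cartan_def U.scale_right_distrib scale_mult add_ac mult_ac del: skew_pow.simps)
  also have "inverse v ^ n * v ^ (2 * n) = v ^ n"
    by (simp add: mult_2 power_add power_inverse)
  also have "v ^ n * v ^ 2 * v ^ n = v ^ (2 * Suc n)"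
    by (simp add: power_add mult_2 power2_eq_square)
  finally show ?case unfolding c
    by (simp add: qint_Suc_rec(1) U.scale_left_distrib add.assoc del: skew_pow.simps(2))
qed

lemma skew_pow_nilpotent: "\<exists>N. \<forall>n\<ge>N. skew_pow i n y = 0"
proof (induction y rule: Uplus_induct)
  case one
  then show ?case by (intro exI[of _ 1]) (simp add: skew_pow_1)
next
  case (gen j x)
  then obtain N where N: "\<And>n. n \<ge> N \<Longrightarrow> skew_pow i n x = 0" by blast
  have "skew_pow i n (E j * x) = 0" if "n \<ge> Suc N" for n
  proof (cases "i = j")
    case True
    then show ?thesis using that N by (simp add: skew_pow_E_mult)
  next
    case False
    have "divpow j 1 = E j" by (simp add: divpow_Suc)
    then show ?thesis using skew_pow_divpow_other[OF False, of n 1 x] that N by simp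
  qed
  then show ?case by blast
next
  case (add x y)
  then obtain M N where "\<And>n. n \<ge> M \<Longrightarrow> skew_pow i n x = 0" "\<And>n. n \<ge> N \<Longrightarrow> skew_pow i n y = 0" by blast
  then show ?case by (intro exI[of _ "max M N"]) (simp add: skew_pow_add)
next
  case (scale c x)
  then show ?case by (auto simp: skew_pow_scale)
qed

text \<open>
  Since skew derivations are locally nilpotent, vanishing can be propagated downwards from a high
  power.  Both cancellation laws below are instances.
\<close>

lemma skew_pow_descent:
  assumes "\<And>n. skew_pow i (Suc n) z = 0 \<Longrightarrow> skew_pow i n z = 0"
  shows "z = 0"
proof -
  obtain N where "skew_pow i N z = 0" using skew_pow_nilpotent by blast
  then have "skew_pow i 0 z = 0"
  proof (induction N)
    case (Suc N)
    show ?case by (rule Suc.IH[OF assms[OF Suc.prems]])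
  qed
  then show ?thesis by simp
qed

lemma E_mult_eq_0:
  assumes "E i * z = 0" shows "z = 0"
proof (rule skew_pow_descent[of i])
  fix n assume "skew_pow i (Suc n) z = 0"
  then have "qint (Suc n) \<cdot> skew_pow i n z = 0"
    using skew_pow_E_mult[of i "Suc n" z] by (simp add: assms del: skew_pow.simps)
  then show "skew_pow i n z = 0" by (simp add: qint_nonzero)
qed

lemma E_power_mult_eq_0: "E i ^ n * z = 0 \<Longrightarrow> z = 0"
  by (induction n) (auto simp: mult.assoc dest: E_mult_eq_0)

text \<open>
  Elements all of whose weight components \<open>\<nu>\<close> satisfy \<open>\<nu> \<cdot> i = e\<close>.  The number \<open>e\<close> is all that the Leibniz rule for the
  skew derivation along \<open>i\<close> depends on, so the full weight is not recorded.
\<close>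

inductive homogeneous :: "node \<Rightarrow> int \<Rightarrow> Uplus \<Rightarrow> bool" for i where
  zero: "homogeneous i e 0"
| one: "homogeneous i 0 1"
| gen: "homogeneous i (cartan i j) (E j)"
| mult: "homogeneous i e x \<Longrightarrow> homogeneous i f y \<Longrightarrow> homogeneous i (e + f) (x * y)"
| add: "homogeneous i e x \<Longrightarrow> homogeneous i e y \<Longrightarrow> homogeneous i e (x + y)"
| scale: "homogeneous i e x \<Longrightarrow> homogeneous i e (c \<cdot> x)"

lemma skew_mult_homogeneous:
  "homogeneous i e x \<Longrightarrow> skew i (x * w) = skew i x * w + v powi e \<cdot> (x * skew i w)"
proof (induction arbitrary: w rule: homogeneous.induct)
  case (gen j)
  show ?case using skew_E_mult[of i j 1] by (simp add: skew_E_mult)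
next
  case (mult e x f y)
  then show ?case
    by (simp add: mult.assoc distrib_left distrib_right U.scale_right_distrib scale_mult power_int_add add.assoc)
next
  case (scale e x c)
  then show ?case by (simp add: skew_scale scale_mult U.scale_right_distrib mult.commute)
qed (simp_all add: skew_add distrib_left distrib_right U.scale_right_distrib add_ac)

lemma homogeneous_skew: "homogeneous i e x \<Longrightarrow> homogeneous i (e - 2) (skew i x)"
proof (induction rule: homogeneous.induct)
  case (gen j)
  show ?case using skew_E_mult[of i j 1] homogeneous.one by (auto simp: cartan_def homogeneous.zero)
next
  case (mult e x f y)
  have "homogeneous i (e - 2 + f) (skew i x * y)" "homogeneous i (e + (f - 2)) (x * skew i y)"
    using mult by (auto intro: homogeneous.mult)
  then show ?case
    by (auto simp: skew_mult_homogeneous[OF mult(1)] algebra_simps intro!: homogeneous.add homogeneous.scale)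
qed (auto simp: skew_add skew_scale homogeneous.zero intro: homogeneous.intros)

lemma homogeneous_skew_pow: "homogeneous i e x \<Longrightarrow> homogeneous i (e - 2 * int n) (skew_pow i n x)"
proof (induction n)
  case (Suc n)
  have "homogeneous i (e - 2 * int n - 2) (skew_pow i (Suc n) x)"
    using Suc by (simp add: homogeneous.scale homogeneous_skew)
  then show ?case by (simp add: algebra_simps)
qed simp

lemma skew_pow_mult_E:
  assumes "homogeneous i e z"
  shows "skew_pow i n (z * E i) = skew_pow i n z * E i + (v powi (e - 2 * int n + 2) * qint n) \<cdot> skew_pow i (n - 1) z"
proof (induction n)
  case 0
  show ?case by (simp add: qint_def)
next
  case (Suc n)
  have E: "skew i (E i) = 1" using skew_E_mult[of i i 1] by simp
  have i: "inverse v ^ l = v powi (- int l)" for l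
    by (simp add: power_int_minus power_inverse)
  have c: "inverse v ^ n * (v powi (e - 2 * int n + 2) * (qint n * v ^ (n - 1))) = v powi (e - 2 * int n) * (v * qint n)"
  proof (cases n)
    case (Suc m)
    have "v powi (- int n) * v powi (e - 2 * int n + 2) * v powi (int m) = v powi (e - 2 * int n) * v powi 1"
      unfolding power_int_add[symmetric, OF disjI1[OF v_nonzero]] by (simp add: Suc algebra_simps)
    then show ?thesis unfolding i by (simp add: Suc mult_ac)
  qed (simp add: qint_def)
  have c': "inverse v ^ n * v powi (e - 2 * int n) = v powi (e - 2 * int n) * inverse v ^ n" by simp
  have d: "qint n \<cdot> skew i (skew_pow i (n - 1) z) = (qint n * v ^ (n - 1)) \<cdot> skew_pow i n z"
  proof (cases n)
    case (Suc m)
    then show ?thesis by (simp add: skew_skew_pow del: skew_pow.simps)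
  qed (simp add: qint_def)
  have "skew i ((v powi (e - 2 * int n + 2) * qint n) \<cdot> skew_pow i (n - 1) z)
     = (v powi (e - 2 * int n + 2) * (qint n * v ^ (n - 1))) \<cdot> skew_pow i n z"
    using arg_cong[OF d, of "scale (v powi (e - 2 * int n + 2))"] by (simp add: skew_scale)
  then have "skew_pow i (Suc n) (z * E i) = skew_pow i (Suc n) z * E i
      + (inverse v ^ n * v powi (e - 2 * int n)) \<cdot> skew_pow i n z
      + (inverse v ^ n * (v powi (e - 2 * int n + 2) * (qint n * v ^ (n - 1)))) \<cdot> skew_pow i n z"
    by (simp add: Suc.IH skew_add skew_mult_homogeneous[OF homogeneous_skew_pow[OF assms]] E
        U.scale_right_distrib scale_mult add.assoc)
  also have "\<dots> = skew_pow i (Suc n) z * E i + (v powi (e - 2 * int (Suc n) + 2) * qint (Suc n)) \<cdot> skew_pow i n z"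
    unfolding c c' qint_Suc_rec(2) by (simp add: U.scale_left_distrib distrib_left add.assoc del: skew_pow.simps)
  finally show ?case by simp
qed

text \<open>
  Applying the Leibniz rule to \<open>z E\<^sub>i = 0\<close> expresses a nonzero multiple of each power of the skew
  derivation at \<open>z\<close> through the next higher power.
\<close>

lemma mult_E_eq_0:
  assumes "homogeneous i e z" "z * E i = 0" shows "z = 0"
proof (rule skew_pow_descent[of i])
  fix n assume "skew_pow i (Suc n) z = 0"
  then have "(v powi (e - 2 * int n) * qint (Suc n)) \<cdot> skew_pow i n z = 0"
    using skew_pow_mult_E[OF assms(1), of "Suc n"] by (simp add: assms(2) del: skew_pow.simps)
  then show "skew_pow i n z = 0" by (simp add: qint_nonzero)
qed

lemma mult_E_power_eq_0:
  assumes "homogeneous i e z" "z * E i ^ n = 0" shows "z = 0"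
  using assms
proof (induction n arbitrary: e z)
  case (Suc n)
  have "homogeneous i (e + cartan i i) (z * E i)" using Suc.prems by (intro homogeneous.intros)
  then have "z * E i = 0" using Suc.IH Suc.prems by (simp add: mult.assoc)
  then show ?case using mult_E_eq_0 Suc.prems by blast
qed simp

text \<open>
  The truncation of Kashiwara's projection onto the kernel of the skew derivation along \<open>E\<^sub>i U\<^sup>+\<close>.
  The full series is locally finite; with a truncation its value on \<open>E\<^sub>i y\<close> telescopes to one
  explicit term, which vanishes as soon as the \<open>N\<close>-th skew power of \<open>y\<close> does.
\<close>

definition kernel_projection :: "node \<Rightarrow> nat \<Rightarrow> Uplus \<Rightarrow> Uplus" where
  "kernel_projection i N y = (\<Sum>k\<le>N. ((- 1) ^ k * v ^ (k * (k - 1))) \<cdot> (divpow i k * skew_pow i k y))"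

lemma kernel_projection_E_mult:
  "kernel_projection i N (E i * y) = ((- 1) ^ N * v ^ (N * Suc N) * qint (Suc N)) \<cdot> (divpow i (Suc N) * skew_pow i N y)"
proof (induction N)
  case 0
  show ?case by (simp add: kernel_projection_def divpow_Suc)
next
  case (Suc N)
  let ?s = "(- 1) ^ N * v ^ (N * Suc N)"
  have D: "divpow i (Suc N) * (E i * w) = qint (Suc (Suc N)) \<cdot> (divpow i (Suc (Suc N)) * w)" for w
    by (simp add: divpow_commute_E E_mult_divpow scale_mult flip: mult.assoc)
  have cancel: "A + - B + - A = - B" for A B :: Uplus by simp
  have NS: "v ^ (Suc N * (Suc N - 1)) = v ^ (N * Suc N)" by (simp only: diff_Suc_1 mult.commute)
  have "kernel_projection i (Suc N) (E i * y) = kernel_projection i N (E i * y)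
     + (- ?s) \<cdot> (divpow i (Suc N) * skew_pow i (Suc N) (E i * y))"
    unfolding kernel_projection_def sum.atMost_Suc NS by simp
  also have "\<dots> = (?s * qint (Suc N)) \<cdot> (divpow i (Suc N) * skew_pow i N y)
     + (- ?s * v ^ (2 * Suc N) * qint (Suc (Suc N))) \<cdot> (divpow i (Suc (Suc N)) * skew_pow i (Suc N) y)
     + (- ?s * qint (Suc N)) \<cdot> (divpow i (Suc N) * skew_pow i N y)"
    unfolding Suc.IH skew_pow_E_mult distrib_left scale_mult D U.scale_right_distrib U.scale_scale diff_Suc_1
    by (simp only: add.assoc mult.assoc)
  also have "\<dots> = (- ?s * v ^ (2 * Suc N) * qint (Suc (Suc N))) \<cdot> (divpow i (Suc (Suc N)) * skew_pow i (Suc N) y)"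
    by (simp only: mult_minus_left U.scale_minus_left cancel)
  also have "- ?s * v ^ (2 * Suc N) = (- 1) ^ Suc N * v ^ (Suc N * Suc (Suc N))"
  proof -
    have "N * Suc N + 2 * Suc N = Suc N * Suc (Suc N)" by simp
    then have "v ^ (N * Suc N) * v ^ (2 * Suc N) = v ^ (Suc N * Suc (Suc N))" by (simp only: flip: power_add)
    then show ?thesis by (simp only: power_Suc[of "- 1"] mult_minus1 mult_minus_left mult.assoc)
  qed
  finally show ?case .
qed

text \<open>
  Right multiplication by \<open>E\<^sub>j\<close> commutes with the skew derivation along \<open>i\<close> up to the term containing
  the derivative of \<open>E\<^sub>j\<close>, which is \<open>0\<close>.
\<close>

lemma kernel_projection_mult_divpow:
  assumes "i \<noteq> j"
  shows "kernel_projection i N (divpow j b * (divpow i c * divpow j d))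
    = kernel_projection i N (divpow j b * divpow i c) * divpow j d"
  using skew_pow_three_factors[OF assms, of _ b c 0]
  by (simp add: kernel_projection_def skew_pow_three_factors[OF assms] sum_distrib_right scale_mult mult.assoc)

lemma homogeneous_divpow: "homogeneous i (int n * cartan i j) (divpow j n)"
proof (induction n)
  case 0
  show ?case using homogeneous.one by simp
next
  case (Suc n)
  have "homogeneous i (cartan i j + int n * cartan i j) (divpow j (Suc n))"
    unfolding divpow_Suc by (intro homogeneous.intros Suc)
  then show ?case by (simp add: algebra_simps)
qed

lemma homogeneous_sum: "(\<And>k. k \<in> A \<Longrightarrow> homogeneous i e (f k)) \<Longrightarrow> homogeneous i e (sum f A)"
  by (induction A rule: infinite_finite_induct) (auto intro: homogeneous.intros)

lemma homogeneous_kernel_projection: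
  assumes "i \<noteq> j"
  shows "homogeneous j (2 * int b - 2 * int c) (kernel_projection i N (divpow j b * divpow i c))"
  unfolding kernel_projection_def
proof (intro homogeneous_sum homogeneous.scale)
  fix k
  show "homogeneous j (2 * int b - 2 * int c) (divpow i k * skew_pow i k (divpow j b * divpow i c))"
  proof (cases "k \<le> c")
    case True
    have "homogeneous j (int k * cartan j i + (int b * cartan j j + int (c - k) * cartan j i))
        (divpow i k * (divpow j b * divpow i (c - k)))"
      by (intro homogeneous.mult homogeneous_divpow)
    moreover have "int k * cartan j i + (int b * cartan j j + int (c - k) * cartan j i) = 2 * int b - 2 * int c"
      using True assms by (simp add: cartan_def of_nat_diff)
    ultimately show ?thesis
      using True skew_pow_three_factors[OF assms, of k b c 0]
      by (simp add: divpow_drop_def scale_mult homogeneous.scale)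
  next
    case False
    then show ?thesis
      using skew_pow_three_factors[OF assms, of k b c 0]
      by (simp add: divpow_drop_def homogeneous.zero)
  qed
qed

text \<open>
  By adjunction the pairing is an alternating sum of norms of skew powers of \<open>x\<close>.  The \<open>k\<close>-th of them
  has exponent \<open>- k (k + 1 + 4b - 2c)\<close>, which is negative for \<open>k > 0\<close> because \<open>c \<le> 2b\<close>, so only
  \<open>(x, x)\<close> contributes to the leading term.
\<close>

lemma form_kernel_projection:
  assumes "i \<noteq> j" "c \<le> 2 * b"
  defines "x \<equiv> divpow j b * divpow i c"
  shows "form x (kernel_projection i N x) - 1 \<in> vanishing_at_infinity"
proof -
  define e where "e k = (int c - int k) * int k - 2 * int b * int k" for k
  define t where "t k = v ^ (k * (k - 1)) * kappa k * form (skew_pow i k x) (skew_pow i k x)" for k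
  have norm: "form (divpow j b * divpow i m) (divpow j b * divpow i m) = kappa b * kappa m" for m
    using form_two_factors[of j i 0 b 0 m] assms(1) by simp
  have skew: "skew_pow i k x = v powi (e k) \<cdot> (divpow j b * divpow_drop i c k)" for k
    using skew_pow_three_factors[OF assms(1), of k b c 0] by (simp add: x_def e_def)
  have asymp: "asymp_v (- (int k * (int k + 1 + 4 * int b - 2 * int c))) (t k)" if "k \<le> c" for k
  proof -
    have "t k = v powi int (k * (k - 1)) * kappa k * (v powi (e k) * (v powi (e k) * (kappa b * kappa (c - k))))"
      using that unfolding power_int_of_nat
      by (simp add: t_def skew form_scale_left form_scale_right divpow_drop_def norm)
    moreover have "asymp_v (int (k * (k - 1)) + 0 + (e k + (e k + (0 + 0)))) \<dots>"
      by (intro asymp_v_mult asymp_v_kappa asymp_v_power_int)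
    moreover have "int (k * (k - 1)) + 0 + (e k + (e k + (0 + 0))) = - (int k * (int k + 1 + 4 * int b - 2 * int c))"
      by (cases k) (simp_all add: e_def algebra_simps)
    ultimately show ?thesis by metis
  qed
  have "t k \<in> vanishing_at_infinity" if "k > 0" for k
  proof (cases "k \<le> c")
    case True
    have "0 < int k * (int k + 1 + 4 * int b - 2 * int c)" using assms that by simp
    then show ?thesis using asymp_v_negative_vanishing[OF asymp[OF True]] by simp
  next
    case False
    then show ?thesis by (simp add: t_def skew divpow_drop_def)
  qed
  then have "(- 1) ^ k * t k \<in> vanishing_at_infinity" if "k > 0" for k
    using that by (cases "even k") (auto intro: vanishing_uminus)
  then have "(\<Sum>k<N. (- 1) ^ Suc k * t (Suc k)) \<in> vanishing_at_infinity"
    by (intro vanishing_sum) blast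
  moreover have "t 0 - 1 \<in> vanishing_at_infinity"
    using asymp[of 0] by (simp add: asymp_v_def)
  ultimately have "(\<Sum>k<N. (- 1) ^ Suc k * t (Suc k)) + (t 0 - 1) \<in> vanishing_at_infinity"
    by (rule vanishing_add)
  moreover have "form x (kernel_projection i N x) = (\<Sum>k\<le>N. (- 1) ^ k * t k)"
    by (simp add: kernel_projection_def form_sum_right form_scale_right t_def mult.assoc
        form_sym[of x "divpow i _ * _"] form_divpow_left)
  ultimately show ?thesis
    by (simp add: sum.atMost_shift algebra_simps)
qed

text \<open>
  If the monomial were left divisible by \<open>E\<^sub>i\<close>, its projection would vanish; cancelling
  \<open>E\<^sub>j\<^bsup>(d)\<^esup>\<close> on the right, so would the projection of \<open>E\<^sub>j\<^bsup>(b)\<^esup> E\<^sub>i\<^bsup>(c)\<^esup>\<close>, contradicting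
  \<open>form_kernel_projection\<close>.  Pairing with the full monomial instead would not do, since there
  terms of positive order may cancel.
\<close>

proposition not_left_divisible:
  assumes "i \<noteq> j" "c \<le> 2 * b"
  shows "divpow j b * (divpow i c * divpow j d) \<noteq> E i * y"
proof
  assume eq: "divpow j b * (divpow i c * divpow j d) = E i * y"
  obtain N where N: "skew_pow i N y = 0" using skew_pow_nilpotent by blast
  let ?z = "kernel_projection i N (divpow j b * divpow i c)"
  have "?z * divpow j d = 0"
    using kernel_projection_E_mult[of i N y] N by (simp add: kernel_projection_mult_divpow[OF assms(1), symmetric] eq)
  then have "inverse (qfact d) \<cdot> (?z * E j ^ d) = 0" by (simp add: divpow_def scale_mult)
  moreover have "qfact d \<noteq> 0" by (simp add: qfact_def qint_nonzero)
  ultimately have "?z * E j ^ d = 0" by simp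
  then have "?z = 0" using mult_E_power_eq_0 homogeneous_kernel_projection[OF assms(1)] by blast
  then have "- 1 \<in> vanishing_at_infinity" using form_kernel_projection[OF assms, of N] by simp
  then show False using vanishing_uminus[of "- 1"] of_nat_vanishing_iff[of 1] by simp
qed

section \<open>Membership in the canonical basis\<close>

lemma bar_divpow [simp]: "bar (divpow i n) = divpow i n"
proof -
  have "bar 1 = 1" by transfer (simp add: serre_ideal.zero)
  then have "bar (E i ^ n) = E i ^ n" by (induction n) (simp_all add: bar_mult bar_E)
  then show ?thesis by (simp add: divpow_def bar_scale bar_Qv_inverse)
qed

lemma monomial4_signed_basis_iff:
  "monomial4 i j a b c d \<in> signed_basis \<longleftrightarrow>
   form (monomial4 i j a b c d) (monomial4 i j a b c d) - 1 \<in> vanishing_at_infinity"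
  by (simp add: signed_basis_def bar_mult integral_form.mult integral_form.divpow)

lemma canonical_basis_subset_signed_basis: "canonical_basis \<subseteq> signed_basis"
proof
  fix x assume "x \<in> canonical_basis"
  then show "x \<in> signed_basis"
  proof induction
    case one
    have "bar 1 = 1" "1 \<in> integral_form"
      using bar_divpow[of N1 0] integral_form.divpow[of N1 0] by simp_all
    then show ?case by (simp add: signed_basis_def form_1_1)
  qed (simp add: string_shift_def signed_basis_eq_def signed_basis_ge_def)
qed

text \<open>
  The string bijection in the simplest situation, where \<open>E\<^sub>i\<^bsup>(n)\<^esup> x\<close> itself is a signed basis element:
  no correction by elements divisible by higher powers of \<open>E\<^sub>i\<close> occurs.  Since \<open>E\<^sub>i\<close> does not
  divide \<open>x\<close> and can be cancelled on the left, \<open>E\<^sub>i\<^bsup>(n)\<^esup> x\<close> is divisible by no power of \<open>E\<^sub>i\<close> beyond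
  the \<open>n\<close>-th.
\<close>

lemma canonical_basis_divpow_mult:
  assumes "x \<in> canonical_basis" "n > 0" "\<And>y. x \<noteq> E i * y" "divpow i n * x \<in> signed_basis"
  shows "divpow i n * x \<in> canonical_basis"
proof (rule canonical_basis.shift[OF assms(1,2)])
  have x: "x \<in> signed_basis" using assms(1) canonical_basis_subset_signed_basis by blast
  have qf: "qfact n \<noteq> 0" by (simp add: qfact_def qint_nonzero)
  have "divpow i n * x \<noteq> E i ^ Suc n * y" for y
  proof
    assume "divpow i n * x = E i ^ Suc n * y"
    then have "E i ^ n * (inverse (qfact n) \<cdot> x - E i * y) = 0"
      by (simp add: divpow_def scale_mult right_diff_distrib power_commutes flip: mult.assoc)
    then have "inverse (qfact n) \<cdot> x = E i * y"
      using E_power_mult_eq_0 by fastforce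
    from arg_cong[OF this, of "scale (qfact n)"] have "x = E i * (qfact n \<cdot> y)"
      using qf by (simp add: scale_mult)
    then show False using assms(3) by blast
  qed
  moreover have "divpow i n * x = E i ^ n * (inverse (qfact n) \<cdot> x)"
    by (simp add: divpow_def scale_mult)
  ultimately have "divpow i n * x \<in> signed_basis_eq i n"
    using assms(4) by (auto simp: signed_basis_eq_def signed_basis_ge_def simp del: power_Suc)
  moreover have "x \<in> signed_basis_eq i 0"
    using x assms(3) by (auto simp: signed_basis_eq_def signed_basis_ge_def)
  moreover have "0 \<in> laurent_span S" for S
    unfolding laurent_span_def by (rule CollectI, rule exI[of _ "{}"]) simp
  ultimately show "string_shift i n x (divpow i n * x)"
    by (simp add: string_shift_def)
qed

text \<open>
  In the chain from \<open>1\<close> to the monomial, the norm criterion with \<open>a = 0\<close> or \<open>a = b = 0\<close> shows that the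
  intermediate products are signed basis elements, and the inequalities \<open>a + c \<le> 2b\<close> and
  \<open>b + d \<le> 2c\<close> provide the bounds \<open>c \<le> 2b\<close> and \<open>d \<le> 2c\<close> needed for non-divisibility.
\<close>

lemma monomial4_canonical_basis_iff:
  assumes "i \<noteq> j" "a > 0" "b > 0" "c > 0" "d > 0"
  shows "monomial4 i j a b c d \<in> canonical_basis \<longleftrightarrow>
    2 * b \<ge> a + c \<and> 2 * c \<ge> b + d \<and> (2 * b > a + c \<or> 2 * c > b + d)" (is "_ \<longleftrightarrow> ?R")
proof
  assume "monomial4 i j a b c d \<in> canonical_basis"
  then have "monomial4 i j a b c d \<in> signed_basis" using canonical_basis_subset_signed_basis by blast
  then show ?R
    unfolding monomial4_signed_basis_iff norm_four_positive_factors_asymptotic_to_1_iff[OF assms] .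
next
  assume R: ?R
  note ji = assms(1)[symmetric]
  note signed = monomial4_signed_basis_iff norm_four_factors_asymptotic_to_1_iff[OF assms(1)]
  have "monomial4 i j 0 0 0 d \<in> signed_basis" unfolding signed by simp
  then have 1: "divpow j d * 1 \<in> canonical_basis"
    using not_left_divisible[OF ji, of 0 0 0] assms
    by (intro canonical_basis_divpow_mult canonical_basis.one) simp_all
  have "monomial4 i j 0 0 c d \<in> signed_basis" unfolding signed by simp
  then have 2: "divpow i c * divpow j d \<in> canonical_basis"
    using not_left_divisible[OF assms(1), of 0 0 d] assms 1
    by (auto intro!: canonical_basis_divpow_mult)
  have "0 < int y * (2 * int c - int b - int d) + (int y)^2" if "y > 0" for y
    using that R by (intro add_nonneg_pos mult_nonneg_nonneg) simp_all
  then have "monomial4 i j 0 b c d \<in> signed_basis" unfolding signed by simp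
  then have 3: "divpow j b * (divpow i c * divpow j d) \<in> canonical_basis"
    using not_left_divisible[OF ji, of d c 0] assms 2 R
    by (auto intro!: canonical_basis_divpow_mult)
  have "monomial4 i j a b c d \<in> signed_basis"
    using R unfolding monomial4_signed_basis_iff norm_four_positive_factors_asymptotic_to_1_iff[OF assms] .
  then show "monomial4 i j a b c d \<in> canonical_basis"
    using not_left_divisible[OF assms(1), of c b d] assms 3 R
    by (auto intro!: canonical_basis_divpow_mult)
qed

theorem corollary8p3:
  fixes i1 i2 i3 i4 :: node and a b c d :: nat
  assumes "(i1, i2, i3, i4) \<in> {(N1, N2, N1, N2), (N2, N1, N2, N1)}"
    and "a > 0" "b > 0" "c > 0" "d > 0"
  shows "tight (divpow i1 a * divpow i2 b * divpow i3 c * divpow i4 d) \<longleftrightarrow>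
    2 * b \<ge> a + c \<and> 2 * c \<ge> b + d \<and> (2 * b > a + c \<or> 2 * c > b + d)"
proof -
  have "i1 \<noteq> i2" "i3 = i1" "i4 = i2" using assms(1) by auto
  then show ?thesis
    using monomial4_canonical_basis_iff[of i1 i2 a b c d] assms by (simp add: tight_def mult.assoc)
qed

end
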